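(* Let $\mathcal{G}$ be a locally compact group and let $\mathcal{X}$ be a $\mathcal{G}$-space. Then the following statements hold. (a) The action of $LUC(\mathcal{G})^*$ on $LUC(\mathcal{X},\mathcal{G})^*$ is faithful if and only if $\mathcal{CLS}(\mathcal{X},\mathcal{G})=LUC(\mathcal{G})$. (b) If the action of $LUC(\mathcal{G})^*$ on $LUC(\mathcal{X},\mathcal{G})^*$ is faithful, then $\mathcal{G}$ acts effectively on $\mathcal{X}$. (c) If $\mathcal{X}$ is compact, then $M(\mathcal{X})$ is an $LUC(\mathcal{G})^*$-submodule of $LUC(\mathcal{X},\mathcal{G})^*$. The converse is also true if $\mathcal{X}$ is a transitive $\mathcal{G}$-space.
   Context: A (left) $\mathcal{G}$-space is a locally compact Hausdorff space $\mathcal{X}$ with a continuous map $\mathcal{G}\times\mathcal{X}\to\mathcal{X}$, $(s,x)\mapsto s\cdot x$, such that $(st)\cdot x=s\cdot(t\cdot x)$ and $e\cdot x=x$ for all $s,t\in\mathcal{G}$, $x\in\mathcal{X}$, where $e$ is the identity of $\mathcal{G}$. It is transitive if for all $x,y\in\mathcal{X}$ there is $s\in\mathcal{G}$ with $y=s\cdot x$. The action is effective if $\mathfrak{N}(\mathcal{X},\mathcal{G})=\{s\in\mathcal{G}: s\cdot x=x \text{ for all } x\in\mathcal{X}\}$ equals $\{e\}$. $C_b(\mathcal{X})$ is the space of bounded continuous complex-valued functions on $\mathcal{X}$ with the supremum norm. For $F\in C_b(\mathcal{X})$ and $s\in\mathcal{G}$ put $(l_sF)(x)=F(s\cdot x)$,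 and let $$LUC(\mathcal{X},\mathcal{G})=\{F\in C_b(\mathcal{X}): s\mapsto l_sF \text{ is continuous from } \mathcal{G} \text{ into } (C_b(\mathcal{X}),\|\cdot\|_\infty)\},$$ a closed subspace of $C_b(\mathcal{X})$ invariant under all $l_s$. $LUC(\mathcal{G})=LUC(\mathcal{G},\mathcal{G})$, with $\mathcal{G}$ acting on itself by left translation; write ${}_sf(t)=f(st)$. $LUC(\mathcal{G})^*$ is a Banach algebra with the product $\langle m\odot n,f\rangle=\langle m,n\diamond f\rangle$, where $(n\diamond f)(s)=\langle n,{}_sf\rangle$. For $M\in LUC(\mathcal{X},\mathcal{G})^*$ and $F\in LUC(\mathcal{X},\mathcal{G})$, the function $MF\in LUC(\mathcal{G})$ is given by $(MF)(s)=\langle M,l_sF\rangle$. $LUC(\mathcal{X},\mathcal{G})^*$ is a Banach left $LUC(\mathcal{G})^*$-module via $\langle m\cdot M,F\rangle=\langle m,MF\rangle$. This action is called faithful if, whenever $m\in LUC(\mathcal{G})^*$ satisfies $m\cdot M=0$ for all $M\in LUC(\mathcal{X},\mathcal{G})^*$, one has $m=0$. $\mathcal{CLS}(\mathcal{X},\mathcal{G})$ is the norm closure in $LUC(\mathcal{G})$ of the linear span of $\{MF: M\in LUC(\mathcal{X},\mathcal{G})^*,\ F\in LUC(\mathcal{X},\mathcal{G})\}$. $M(\mathcal{X})$, the space of complex Radon measures on $\mathcal{X}$, is regarded as a subspace of $LUC(\mathcal{X},\mathcal{G})^*$ by letting $\sigma\in M(\mathcal{X})$ act as $F\mapsto\int_{\mathcal{X}}F\,d\sigma$.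 It is an $LUC(\mathcal{G})^*$-submodule if $m\cdot\sigma\in M(\mathcal{X})$ for all $m\in LUC(\mathcal{G})^*$, $\sigma\in M(\mathcal{X})$. *)

theory Defs
  imports "HOL-Analysis.Analysis"
begin

text \<open>
  Groups are written additively because the library's class of (not necessarily commutative)
  topological groups is \<^class>\<open>topological_group_add\<close>: \<open>s + t\<close> is the product \<open>st\<close> and \<open>0\<close> is
  the identity. Hausdorffness of the group and of the space is the sort \<^class>\<open>t2_space\<close>.
\<close>

locale G_space =
  fixes act :: "'g::{topological_group_add,t2_space} \<Rightarrow> 'x::t2_space \<Rightarrow> 'x"
  assumes locally_compact: "locally_compact_space (euclidean :: 'x topology)"
    and continuous_act: "continuous_on UNIV (\<lambda>(s, x). act s x)"
    and act_add: "act (s + t) x = act s (act t x)"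
    and act_zero: "act 0 x = x"

definition transitive_action :: "('g::group_add \<Rightarrow> 'x \<Rightarrow> 'x) \<Rightarrow> bool" where
  "transitive_action act \<longleftrightarrow> (\<forall>x y. \<exists>s. y = act s x)"

definition action_kernel :: "('g::group_add \<Rightarrow> 'x \<Rightarrow> 'x) \<Rightarrow> 'g set" where
  "action_kernel act = {s. \<forall>x. act s x = x}"

definition effective_action :: "('g::group_add \<Rightarrow> 'x \<Rightarrow> 'x) \<Rightarrow> bool" where
  "effective_action act \<longleftrightarrow> action_kernel act = {0}"

text \<open>
  The library equips \<open>'a \<Rightarrow>\<^sub>C complex\<close> with the supremum norm, but only with real scalars.
\<close>

definition cscale :: "complex \<Rightarrow> ('a::topological_space \<Rightarrow>\<^sub>C complex) \<Rightarrow> 'a \<Rightarrow>\<^sub>C complex" where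
  "cscale c F = Bcontfun (\<lambda>x. c * F x)"

lemma apply_cscale: "apply_bcontfun (cscale c F) x = c * F x"
proof -
  have "(\<lambda>x. c * F x) \<in> bcontfun"
    by (rule bcontfun_normI[of _ "cmod c * norm F"])
      (auto simp: norm_mult intro!: continuous_intros mult_left_mono norm_bounded)
  then show ?thesis
    by (simp add: cscale_def Bcontfun_inverse)
qed

global_interpretation bcontfun_complex: vector_space cscale
  by unfold_locales (rule bcontfun_eqI; simp add: apply_cscale algebra_simps)+

definition translate :: "('g \<Rightarrow> 'x \<Rightarrow> 'x) \<Rightarrow> 'g \<Rightarrow> ('x::topological_space \<Rightarrow>\<^sub>C complex) \<Rightarrow> 'x \<Rightarrow>\<^sub>C complex"
  where "translate act s F = Bcontfun (\<lambda>x. F (act s x))"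

definition LUC :: "('g::topological_space \<Rightarrow> 'x::topological_space \<Rightarrow> 'x) \<Rightarrow> ('x \<Rightarrow>\<^sub>C complex) set" where
  "LUC act = {F. continuous_on UNIV (\<lambda>s. translate act s F)}"

text \<open>
  A functional on \<open>LUC act\<close> is represented by its extension by \<open>0\<close> to all of \<open>'x \<Rightarrow>\<^sub>C complex\<close>,
  so that equality of functionals is equality of HOL functions. The group acting on itself by
  left translation is \<open>(+)\<close>.
\<close>

definition LUC_dual ::
  "('g::topological_space \<Rightarrow> 'x::topological_space \<Rightarrow> 'x) \<Rightarrow> (('x \<Rightarrow>\<^sub>C complex) \<Rightarrow> complex) set" where
  "LUC_dual act = {M.
     (\<forall>F\<in>LUC act. \<forall>H\<in>LUC act. M (F + H) = M F + M H) \<and>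
     (\<forall>c. \<forall>F\<in>LUC act. M (cscale c F) = c * M F) \<and>
     (\<exists>K. \<forall>F\<in>LUC act. cmod (M F) \<le> K * norm F) \<and>
     (\<forall>F. F \<notin> LUC act \<longrightarrow> M F = 0)}"

definition orbit_fun ::
  "('g::topological_space \<Rightarrow> 'x::topological_space \<Rightarrow> 'x) \<Rightarrow>
   (('x \<Rightarrow>\<^sub>C complex) \<Rightarrow> complex) \<Rightarrow> ('x \<Rightarrow>\<^sub>C complex) \<Rightarrow> 'g \<Rightarrow>\<^sub>C complex" where
  "orbit_fun act M F = Bcontfun (\<lambda>s. M (translate act s F))"

definition module_act ::
  "('g::topological_space \<Rightarrow> 'x::topological_space \<Rightarrow> 'x) \<Rightarrow>
   (('g \<Rightarrow>\<^sub>C complex) \<Rightarrow> complex) \<Rightarrow> (('x \<Rightarrow>\<^sub>C complex) \<Rightarrow> complex) \<Rightarrow> ('x \<Rightarrow>\<^sub>C complex) \<Rightarrow> complex" where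
  "module_act act m M = (\<lambda>F. if F \<in> LUC act then m (orbit_fun act M F) else 0)"

definition faithful_module_act ::
  "('g::{topological_group_add,t2_space} \<Rightarrow> 'x::t2_space \<Rightarrow> 'x) \<Rightarrow> bool" where
  "faithful_module_act act \<longleftrightarrow>
     (\<forall>m\<in>LUC_dual (+). (\<forall>M\<in>LUC_dual act. module_act act m M = (\<lambda>_. 0)) \<longrightarrow> m = (\<lambda>_. 0))"

definition CLS ::
  "('g::{topological_group_add,t2_space} \<Rightarrow> 'x::t2_space \<Rightarrow> 'x) \<Rightarrow> ('g \<Rightarrow>\<^sub>C complex) set" where
  "CLS act = LUC (+) \<inter>
     closure (bcontfun_complex.span {orbit_fun act M F | M F. M \<in> LUC_dual act \<and> F \<in> LUC act})"

definition complex_borel_measure :: "('x::topological_space set \<Rightarrow> complex) \<Rightarrow> bool" where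
  "complex_borel_measure \<sigma> \<longleftrightarrow>
     (\<forall>A. range A \<subseteq> sets borel \<longrightarrow> disjoint_family A \<longrightarrow> (\<lambda>n::nat. \<sigma> (A n)) sums \<sigma> (\<Union>n. A n))"

text \<open>
  The Jordan decomposition of a signed measure \<open>\<nu>\<close> is \<open>pos_variation \<nu> - neg_variation \<nu>\<close>, with
  \<open>\<nu>\<^sup>+ E = sup {\<nu> A | A \<subseteq> E Borel}\<close>. Taking \<open>A = {}\<close> shows that cutting off negative values
  by \<^const>\<open>ennreal\<close> does not affect the supremum.
\<close>

definition pos_variation :: "('x::topological_space set \<Rightarrow> real) \<Rightarrow> 'x measure" where
  "pos_variation \<nu> =
     measure_of UNIV (sets borel) (\<lambda>E. SUP A\<in>{A \<in> sets borel. A \<subseteq> E}. ennreal (\<nu> A))"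

definition neg_variation :: "('x::topological_space set \<Rightarrow> real) \<Rightarrow> 'x measure" where
  "neg_variation \<nu> = pos_variation (\<lambda>E. - \<nu> E)"

definition finite_radon_measure :: "'x::t2_space measure \<Rightarrow> bool" where
  "finite_radon_measure \<mu> \<longleftrightarrow> finite_measure \<mu> \<and> sets \<mu> = sets borel \<and>
     (\<forall>B\<in>sets borel. emeasure \<mu> B = (SUP K\<in>{K. compact K \<and> K \<subseteq> B}. emeasure \<mu> K))"

definition complex_radon_measure :: "('x::t2_space set \<Rightarrow> complex) \<Rightarrow> bool" where
  "complex_radon_measure \<sigma> \<longleftrightarrow> complex_borel_measure \<sigma> \<and>
     finite_radon_measure (pos_variation (\<lambda>E. Re (\<sigma> E))) \<and>
     finite_radon_measure (neg_variation (\<lambda>E. Re (\<sigma> E))) \<and>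
     finite_radon_measure (pos_variation (\<lambda>E. Im (\<sigma> E))) \<and>
     finite_radon_measure (neg_variation (\<lambda>E. Im (\<sigma> E)))"

definition signed_integral :: "('x::topological_space set \<Rightarrow> real) \<Rightarrow> ('x \<Rightarrow> complex) \<Rightarrow> complex" where
  "signed_integral \<nu> F = (LINT x|pos_variation \<nu>. F x) - (LINT x|neg_variation \<nu>. F x)"

definition complex_integral :: "('x::topological_space set \<Rightarrow> complex) \<Rightarrow> ('x \<Rightarrow> complex) \<Rightarrow> complex" where
  "complex_integral \<sigma> F =
     signed_integral (\<lambda>E. Re (\<sigma> E)) F + \<i> * signed_integral (\<lambda>E. Im (\<sigma> E)) F"

definition measure_functional ::
  "('g::topological_space \<Rightarrow> 'x::topological_space \<Rightarrow> 'x) \<Rightarrow> ('x set \<Rightarrow> complex) \<Rightarrow>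
   ('x \<Rightarrow>\<^sub>C complex) \<Rightarrow> complex" where
  "measure_functional act \<sigma> = (\<lambda>F. if F \<in> LUC act then complex_integral \<sigma> F else 0)"

definition measure_functionals ::
  "('g::topological_space \<Rightarrow> 'x::t2_space \<Rightarrow> 'x) \<Rightarrow> (('x \<Rightarrow>\<^sub>C complex) \<Rightarrow> complex) set" where
  "measure_functionals act = measure_functional act ` {\<sigma>. complex_radon_measure \<sigma>}"

definition measures_submodule ::
  "('g::{topological_group_add,t2_space} \<Rightarrow> 'x::t2_space \<Rightarrow> 'x) \<Rightarrow> bool" where
  "measures_submodule act \<longleftrightarrow>
     (\<forall>m\<in>LUC_dual (+). \<forall>M\<in>measure_functionals act. module_act act m M \<in> measure_functionals act)"

subsection \<open>The totalized constructions above have their intended values\<close>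

lemma (in G_space) continuous_act_left: "continuous_on UNIV (act s)"
proof -
  have "continuous_on UNIV ((\<lambda>(s, x). act s x) \<circ> Pair s)"
    by (intro continuous_on_compose continuous_intros continuous_on_subset[OF continuous_act]) auto
  then show ?thesis by (simp add: o_def)
qed

lemma (in G_space) apply_translate: "apply_bcontfun (translate act s F) x = F (act s x)"
proof -
  have "continuous_on UNIV (apply_bcontfun F \<circ> act s)"
    by (intro continuous_on_compose continuous_act_left continuous_on_apply_bcontfun)
  moreover have "bounded (range (apply_bcontfun F \<circ> act s))"
    by (rule bounded_subset[of "range (apply_bcontfun F)"])
       (use apply_bcontfun[of F] in \<open>auto simp: bcontfun_def\<close>)
  ultimately have "(\<lambda>x. F (act s x)) \<in> bcontfun"
    by (simp add: bcontfun_def o_def)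
  then show ?thesis
    by (simp add: translate_def Bcontfun_inverse)
qed

lemma (in G_space) norm_translate_le: "norm (translate act s F) \<le> norm F"
  by (rule norm_bound) (simp add: apply_translate norm_bounded)

lemma (in G_space) translate_translate:
  "translate act s (translate act t F) = translate act (t + s) F"
  by (rule bcontfun_eqI) (simp add: apply_translate act_add)

lemma (in G_space) translate_LUC:
  assumes "F \<in> LUC act"
  shows "translate act s F \<in> LUC act"
proof -
  have "continuous_on UNIV (\<lambda>t. translate act t F)"
    using assms by (simp add: LUC_def)
  then have "continuous_on UNIV (\<lambda>t. translate act (s + t) F)"
    by (rule continuous_on_compose2[where f = "\<lambda>t. s + t"])
      (auto intro: continuous_on_add continuous_on_const continuous_on_id)
  then show ?thesis by (simp add: LUC_def translate_translate)
qed

lemma (in G_space) LUC_diff: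
  assumes "F \<in> LUC act" "H \<in> LUC act"
  shows "F - H \<in> LUC act"
proof -
  have "translate act s (F - H) = translate act s F - translate act s H" for s
    by (rule bcontfun_eqI) (simp add: apply_translate)
  with assms show ?thesis by (auto simp: LUC_def intro: continuous_intros)
qed

lemma LUC_dual_diff:
  assumes "M \<in> LUC_dual act" "F \<in> LUC act" "H \<in> LUC act" "F - H \<in> LUC act"
  shows "M (F - H) = M F - M H"
proof -
  have "M ((F - H) + H) = M (F - H) + M H"
    using assms unfolding LUC_dual_def by blast
  then show ?thesis by simp
qed

lemma (in G_space) apply_orbit_fun:
  assumes M: "M \<in> LUC_dual act" and F: "F \<in> LUC act"
  shows "apply_bcontfun (orbit_fun act M F) s = M (translate act s F)"
proof -
  obtain K0 where K0: "\<forall>H\<in>LUC act. cmod (M H) \<le> K0 * norm H"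
    using M unfolding LUC_dual_def by blast
  define K where "K = max K0 0"
  have K: "cmod (M H) \<le> K * norm H" if "H \<in> LUC act" for H
    using K0 that by (smt (verit) K_def mult_right_mono norm_ge_zero)
  have K_pos: "K \<ge> 0" by (simp add: K_def)
  have "continuous_on UNIV (\<lambda>s. M (translate act s F))"
    unfolding continuous_on_def
  proof
    fix s
    have "((\<lambda>t. translate act t F) \<longlongrightarrow> translate act s F) (at s)"
      using F by (auto simp: LUC_def continuous_on_def)
    then have "((\<lambda>t. K * norm (translate act t F - translate act s F)) \<longlongrightarrow> 0) (at s)"
      by (intro tendsto_mult_right_zero tendsto_norm_zero) (simp add: LIM_zero)
    moreover have "\<forall>\<^sub>F t in at s. norm (M (translate act t F) - M (translate act s F))
        \<le> K * norm (translate act t F - translate act s F)"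
    proof (rule always_eventually, rule allI)
      fix t
      note LUC_ts = translate_LUC[OF F, of t] translate_LUC[OF F, of s]
      show "norm (M (translate act t F) - M (translate act s F))
          \<le> K * norm (translate act t F - translate act s F)"
        using K[OF LUC_diff[OF LUC_ts]] LUC_dual_diff[OF M LUC_ts LUC_diff[OF LUC_ts]] by simp
    qed
    ultimately have "((\<lambda>t. M (translate act t F) - M (translate act s F)) \<longlongrightarrow> 0) (at s)"
      by (rule Lim_null_comparison[rotated])
    then show "((\<lambda>t. M (translate act t F)) \<longlongrightarrow> M (translate act s F)) (at s within UNIV)"
      by (simp add: LIM_zero_cancel)
  qed
  moreover have "cmod (M (translate act s F)) \<le> K * norm F" for s
    using K[OF translate_LUC[OF F]] mult_left_mono[OF norm_translate_le K_pos]
    by (meson order_trans)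
  ultimately have "(\<lambda>s. M (translate act s F)) \<in> bcontfun"
    by (rule bcontfun_normI)
  then show ?thesis
    by (simp add: orbit_fun_def Bcontfun_inverse)
qed

lemma emeasure_pos_variation:
  fixes \<nu> :: "'x::topological_space set \<Rightarrow> real"
  assumes \<nu>: "\<And>A. range A \<subseteq> sets borel \<Longrightarrow> disjoint_family A \<Longrightarrow> (\<lambda>n::nat. \<nu> (A n)) sums \<nu> (\<Union>n. A n)"
    and E: "E \<in> sets borel"
  shows "emeasure (pos_variation \<nu>) E = (SUP A\<in>{A \<in> sets borel. A \<subseteq> E}. ennreal (\<nu> A))"
proof -
  define P where "P = (\<lambda>E. SUP A\<in>{A \<in> sets borel. A \<subseteq> E}. ennreal (\<nu> A))"
  have "(\<lambda>n::nat. \<nu> {}) sums \<nu> {}"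
    using \<nu>[of "\<lambda>_. {}"] by (simp add: disjoint_family_on_def)
  then have empty: "\<nu> {} = 0"
    using summable_const_iff sums_summable by blast
  have le: "ennreal (\<nu> A) \<le> P E" if "A \<in> sets borel" "A \<subseteq> E" for A E
    unfolding P_def using that by (auto intro: SUP_upper)
  have union: "\<nu> (A \<union> B) = \<nu> A + \<nu> B" if "A \<in> sets borel" "B \<in> sets borel" "A \<inter> B = {}" for A B
  proof -
    have "(\<lambda>n. \<nu> (binaryset A B n)) sums \<nu> (\<Union>n. binaryset A B n)"
      using that by (intro \<nu>) (auto simp: binaryset_def disjoint_family_on_def)
    moreover have "(\<lambda>n. \<nu> (binaryset A B n)) sums (\<nu> A + \<nu> B)"
      using binaryset_sums[of \<nu> A B] empty by simp
    ultimately show ?thesis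
      using sums_unique2 by (metis UN_binaryset_eq)
  qed
  have super: "P C + P D \<le> P (C \<union> D)" if "C \<inter> D = {}" for C D
  proof -
    have *: "ennreal (\<nu> A) + ennreal (\<nu> B) \<le> P (C \<union> D)"
      if A: "A \<in> sets borel" "A \<subseteq> C" and B: "B \<in> sets borel" "B \<subseteq> D" for A B
    proof (cases "\<nu> A \<le> 0 \<or> \<nu> B \<le> 0")
      case True
      then show ?thesis
        using le[OF A(1), of "C \<union> D"] le[OF B(1), of "C \<union> D"] A(2) B(2)
        by (auto simp: ennreal_neg le_supI1 le_supI2)
    next
      case False
      then have "ennreal (\<nu> A) + ennreal (\<nu> B) = ennreal (\<nu> (A \<union> B))"
        using union[of A B] A B \<open>C \<inter> D = {}\<close> by (subst union) (auto simp: ennreal_plus)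
      then show ?thesis
        using le[of "A \<union> B" "C \<union> D"] A B by auto
    qed
    have "P C + P D = (SUP B\<in>{B \<in> sets borel. B \<subseteq> D}. P C + ennreal (\<nu> B))"
      unfolding P_def by (subst ennreal_SUP_add_right) auto
    also have "\<dots> = (SUP B\<in>{B \<in> sets borel. B \<subseteq> D}. SUP A\<in>{A \<in> sets borel. A \<subseteq> C}. ennreal (\<nu> A) + ennreal (\<nu> B))"
      unfolding P_def by (subst ennreal_SUP_add_left) auto
    also have "\<dots> \<le> P (C \<union> D)"
      by (intro SUP_least) (use * in auto)
    finally show ?thesis .
  qed
  have P_mono: "P C \<le> P D" if "C \<subseteq> D" for C D
    unfolding P_def using that by (intro SUP_subset_mono) auto
  have P_empty: "P {} = 0"
    by (rule antisym) (auto simp: P_def empty subset_empty intro!: SUP_least)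
  have plus_le: "ennreal (a + b) \<le> ennreal a + ennreal b" for a b
    by (cases "0 \<le> a"; cases "0 \<le> b") (auto simp: ennreal_neg ennreal_plus intro!: ennreal_leI)
  have sum_le: "ennreal (sum f {..<n}) \<le> (\<Sum>i<n. ennreal (f i))" for f and n :: nat
    by (induction n) (auto intro: order_trans[OF plus_le] add_mono)
  have "(\<Sum>i. P (A i)) = P (\<Union>i. A i)"
    if A: "range A \<subseteq> sets borel" "disjoint_family A" for A :: "nat \<Rightarrow> 'x set"
  proof (rule antisym)
    have "(\<Sum>i<n. P (A i)) \<le> P (\<Union>i<n. A i)" for n
    proof (induction n)
      case (Suc n)
      have disj: "(\<Union>i<n. A i) \<inter> A n = {}"
      proof -
        have "A i \<inter> A n = {}" if "i < n" for i
          using disjoint_family_onD[OF A(2), of i n] that by simp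
        then show ?thesis by blast
      qed
      have "(\<Sum>i<Suc n. P (A i)) \<le> P (\<Union>i<n. A i) + P (A n)"
        using add_right_mono[OF Suc] by simp
      also have "\<dots> \<le> P ((\<Union>i<n. A i) \<union> A n)"
        by (rule super[OF disj])
      also have "(\<Union>i<n. A i) \<union> A n = (\<Union>i<Suc n. A i)"
        by (simp only: lessThan_Suc UN_insert Un_commute)
      finally show ?case .
    qed (simp add: P_empty)
    moreover have "P (\<Union>i<n. A i) \<le> P (\<Union>i. A i)" for n
      by (rule P_mono) auto
    ultimately have "(\<Sum>i<n. P (A i)) \<le> P (\<Union>i. A i)" for n
      by (rule order_trans)
    then show "(\<Sum>i. P (A i)) \<le> P (\<Union>i. A i)"
      by (intro suminf_le_const) auto
  next
    show "P (\<Union>i. A i) \<le> (\<Sum>i. P (A i))"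
      unfolding fun_cong[OF P_def, of "\<Union>i. A i"]
    proof (rule SUP_least)
      fix B assume "B \<in> {B \<in> sets borel. B \<subseteq> (\<Union>i. A i)}"
      then have B: "B \<in> sets borel" "B \<subseteq> (\<Union>i. A i)" by auto
      have "(\<lambda>n. \<nu> (B \<inter> A n)) sums \<nu> (\<Union>n. B \<inter> A n)"
        using A B by (intro \<nu>) (auto simp: disjoint_family_on_def)
      moreover have "(\<Union>n. B \<inter> A n) = B" using B by auto
      ultimately have "(\<lambda>n. ennreal (\<Sum>i<n. \<nu> (B \<inter> A i))) \<longlonglongrightarrow> ennreal (\<nu> B)"
        by (intro tendsto_ennrealI) (simp add: sums_def)
      moreover have "ennreal (\<Sum>i<n. \<nu> (B \<inter> A i)) \<le> (\<Sum>i. P (A i))" for n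
      proof -
        have "ennreal (\<Sum>i<n. \<nu> (B \<inter> A i)) \<le> (\<Sum>i<n. P (A i))"
          by (rule order_trans[OF sum_le], rule sum_mono, rule le) (use A B in auto)
        also have "\<dots> \<le> (\<Sum>i. P (A i))"
          by (rule sum_le_suminf) auto
        finally show ?thesis .
      qed
      ultimately show "ennreal (\<nu> B) \<le> (\<Sum>i. P (A i))"
        by (intro LIMSEQ_le_const2) auto
    qed
  qed
  then have "countably_additive (sets borel) P"
    by (simp add: countably_additive_def)
  then have "measure_space UNIV (sets borel) P"
    using sets.sigma_algebra_axioms[of "borel :: 'x measure"]
    by (simp add: measure_space_def positive_def P_empty)
  then have "emeasure (measure_of UNIV (sets borel) P) E = P E"
    using E by (intro emeasure_measure_of_sigma) (auto simp: measure_space_def)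
  then show ?thesis
    unfolding pos_variation_def P_def .
qed

end

theory Submission
  imports Defs
begin

text \<open>
  For (a), a functional \<open>m\<close> annihilates the module iff it vanishes on every function \<open>MF\<close>, so
  by Hahn-Banach faithfulness means that these functions span a dense subspace. For (b), an element
  \<open>s\<close> of the kernel of the action makes \<open>\<delta>\<^sub>s - \<delta>\<^sub>0\<close> vanish on every \<open>MF\<close>, whereas some
  compactly supported function separates \<open>s\<close> from \<open>0\<close>. For (c), if \<open>X\<close> is compact then
  \<open>LUC(X,G) = C(X)\<close> and every bounded functional is a measure by the Riesz representation theorem.
  If \<open>X\<close> is transitive but not compact, Hahn-Banach gives \<open>m\<close> with \<open>m(1) \<noteq> 0\<close> that
  vanishes on the orbit functions of all compactly supported functions, and then
  \<open>m \<cdot> \<delta>\<^sub>x\<close> cannot be a Radon measure.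
\<close>

section \<open>Hahn-Banach separation\<close>

text \<open>Two points beyond the overview shape the work. First, \<open>complex_integral\<close> is
  defined through the Jordan variations of its measure, whereas the Riesz construction delivers some
  pair of positive measures \<mu>1, \<mu>2 whose difference represents a real functional; these need
  not be the Jordan variations of \<mu>1 - \<mu>2. Integrals against different measures must
  therefore be compared. The notion \<open>sandwiched\<close> does this with inequalities on open
  sets alone, and it is used twice: to identify a functional with the integral against the measure
  built from it, and to pass from \<mu>1 - \<mu>2 to its Jordan variations. Second, the
  contradiction in the noncompact transitive case rests on tightness. Transitivity makes the orbit
  of x leave every compact set, so each orbit function of a compactly supported F has a zero and
  stays at distance at least 1 from the constant 1. A Radon measure, by contrast, nearly attains its
  integral of 1 on compactly supported functions, all of which have integral 0 here.\<close>

definition sublinear :: "('a::real_vector \<Rightarrow> real) \<Rightarrow> bool" where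
  "sublinear q \<longleftrightarrow> (\<forall>x y. q (x + y) \<le> q x + q y) \<and> (\<forall>t\<ge>0. \<forall>x. q (t *\<^sub>R x) = t * q x)"

lemma sublinear_add: "sublinear q \<Longrightarrow> q (x + y) \<le> q x + q y"
  and sublinear_scale: "sublinear q \<Longrightarrow> 0 \<le> t \<Longrightarrow> q (t *\<^sub>R x) = t * q x"
  by (auto simp: sublinear_def)

lemma sublinear_zero: "sublinear q \<Longrightarrow> q 0 = 0"
  using sublinear_scale[of q 0 0] by simp

lemma sublinear_minus: "sublinear q \<Longrightarrow> - q (- x) \<le> q x"
  using sublinear_add[of q x "- x"] sublinear_zero[of q] by simp

text \<open>The function r is the infimum over t \<ge> 0 of
  \<open>q (x + t *\<^sub>R y) - t * q y\<close>. The choice t = 0 gives r \<le> q, and t = 1 at -y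
  gives r(-y) \<le> - q(y). The infimum exists since every term is at least - q(-x).\<close>

lemma sublinear_decrease:
  assumes q: "sublinear q"
  obtains r where "sublinear r" "\<And>x. r x \<le> q x" "r (- y) = - q y"
proof -
  define A where "A = (\<lambda>x. (\<lambda>t. q (x + t *\<^sub>R y) - t * q y) ` {0..})"
  define r where "r = (\<lambda>x. Inf (A x))"
  have lower: "- q (- x) \<le> q (x + t *\<^sub>R y) - t * q y" if "t \<ge> 0" for x t
    using sublinear_add[OF q, of "x + t *\<^sub>R y" "- x"] sublinear_scale[OF q that, of y] by simp
  have bdd: "bdd_below (A x)" for x
    unfolding A_def using lower[of _ x] by (intro bdd_belowI2[of _ "- q (- x)"]) auto
  have r_le: "r x \<le> q (x + t *\<^sub>R y) - t * q y" if "t \<ge> 0" for x t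
    unfolding r_def using that by (intro cInf_lower bdd) (auto simp: A_def)
  have r_ge: "c \<le> r x" if "\<And>t. t \<ge> 0 \<Longrightarrow> c \<le> q (x + t *\<^sub>R y) - t * q y" for c x
    unfolding r_def using that by (intro cInf_greatest) (auto simp: A_def)
  have "r (x + z) \<le> r x + r z" for x z
  proof -
    \<comment> \<open>A parameter t for x and a parameter u for z combine to t + u for x + z; the
      two infima are taken one after the other.\<close>
    have "r (x + z) - (q (z + u *\<^sub>R y) - u * q y) \<le> r x" if "u \<ge> 0" for u
    proof (rule r_ge)
      fix t :: real assume "t \<ge> 0"
      then show "r (x + z) - (q (z + u *\<^sub>R y) - u * q y) \<le> q (x + t *\<^sub>R y) - t * q y"
        using r_le[of "t + u" "x + z"] that sublinear_add[OF q, of "x + t *\<^sub>R y" "z + u *\<^sub>R y"]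
        by (simp add: algebra_simps)
    qed
    then have "r (x + z) - r x \<le> r z"
      by (intro r_ge) (simp add: algebra_simps)
    then show ?thesis by simp
  qed
  moreover have "r (c *\<^sub>R x) = c * r x" if c: "c \<ge> 0" for c x
  proof (cases "c = 0")
    case True
    have "r 0 = 0"
      using r_le[of 0 0] r_ge[of 0 0] sublinear_scale[OF q] sublinear_zero[OF q]
      by (force intro: antisym)
    with True show ?thesis by simp
  next
    case False
    have half: "r (c *\<^sub>R x) \<le> c * r x" if "c > 0" for c x
    proof -
      have "r (c *\<^sub>R x) / c \<le> r x"
      proof (rule r_ge)
        fix t :: real assume t: "t \<ge> 0"
        have "r (c *\<^sub>R x) \<le> q (c *\<^sub>R (x + t *\<^sub>R y)) - c * t * q y"
          using r_le[of "c * t" "c *\<^sub>R x"] t that by (simp add: algebra_simps)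
        then show "r (c *\<^sub>R x) / c \<le> q (x + t *\<^sub>R y) - t * q y"
          using that sublinear_scale[OF q, of c "x + t *\<^sub>R y"] by (simp add: field_simps)
      qed
      then show ?thesis using that by (simp add: field_simps)
    qed
    \<comment> \<open>The reverse inequality is \<open>half\<close> for the factor 1/c at the vector
      cx.\<close>
    have "r (inverse c *\<^sub>R (c *\<^sub>R x)) \<le> inverse c * r (c *\<^sub>R x)"
      using c False by (intro half) auto
    with half[of c x] c False show ?thesis by (simp add: field_simps)
  qed
  ultimately have "sublinear r" by (simp add: sublinear_def)
  moreover have "r x \<le> q x" for x
    using r_le[of 0 x] by simp
  moreover have "r (- y) = - q y"
    using r_le[of 1 "- y"] lower[of _ "- y"] sublinear_zero[OF q]
    by (auto intro!: antisym r_ge)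
  ultimately show ?thesis by (rule that)
qed

text \<open>Zorn's lemma for the reversed pointwise order: the pointwise infimum of a nonempty chain
  is again sublinear, and it is finite because every sublinear q \<le> p satisfies q(x) \<ge> -
  q(-x) \<ge> - p(-x).\<close>

lemma minimal_sublinear_below:
  assumes p: "sublinear p"
  obtains q where "sublinear q" "\<And>x. q x \<le> p x"
    "\<And>r. sublinear r \<Longrightarrow> (\<And>x. r x \<le> q x) \<Longrightarrow> r = q"
proof -
  define A where "A = {q. sublinear q \<and> q \<le> p}"
  have "\<exists>m\<in>A. \<forall>a\<in>A. m \<ge> a \<longrightarrow> a = m"
  proof (rule predicate_Zorn)
    show "partial_order_on A (relation_of (\<lambda>q r. r \<le> q) A)"
      by (rule partial_order_on_relation_ofI) auto
  next
    fix C assume "C \<in> Chains (relation_of (\<lambda>q r. r \<le> q) A)"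
    then have C: "C \<subseteq> A" "\<And>q r. q \<in> C \<Longrightarrow> r \<in> C \<Longrightarrow> q \<le> r \<or> r \<le> q"
      by (auto simp: Chains_def relation_of_def)
    show "\<exists>u\<in>A. \<forall>a\<in>C. u \<le> a"
    proof (cases "C = {}")
      case True
      then show ?thesis using p by (auto simp: A_def)
    next
      case False
      define u where "u = (\<lambda>x. INF q\<in>C. q x)"
      have lower: "- p (- x) \<le> q x" if "q \<in> C" for q x
        using C(1) that sublinear_minus[of q x] by (auto simp: A_def le_fun_def intro: order_trans)
           (smt (verit) mem_Collect_eq subset_iff)
      have bdd: "bdd_below ((\<lambda>q. q x) ` C)" for x
        using lower by (intro bdd_belowI2[of _ "- p (- x)"]) auto
      have u_le: "u x \<le> q x" if "q \<in> C" for q x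
        unfolding u_def using that by (intro cINF_lower bdd)
      have u_ge: "c \<le> u x" if "\<And>q. q \<in> C \<Longrightarrow> c \<le> q x" for c x
        unfolding u_def using that False by (intro cINF_greatest)
      have sub: "sublinear q" if "q \<in> C" for q
        using C(1) that by (auto simp: A_def)
      have "u (x + y) \<le> u x + u y" for x y
      proof -
        \<comment> \<open>This uses that C is a chain: the smaller of q and r serves for both x and
          y.\<close>
        have le: "u (x + y) \<le> q x + r y" if "q \<in> C" "r \<in> C" for q r
        proof (cases "q \<le> r")
          case True
          then have "u (x + y) \<le> q x + q y" "q y \<le> r y"
            using u_le[of q "x + y"] sublinear_add[OF sub, of q x y] that by (auto simp: le_fun_def)
          then show ?thesis by simp
        next
          case False
          then have "r \<le> q" using C(2)[OF that] by simp
          then have "u (x + y) \<le> r x + r y" "r x \<le> q x"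
            using u_le[of r "x + y"] sublinear_add[OF sub, of r x y] that by (auto simp: le_fun_def)
          then show ?thesis by simp
        qed
        have "u (x + y) - r y \<le> u x" if "r \<in> C" for r
          using le[OF _ that] by (intro u_ge) (simp add: algebra_simps)
        then have "u (x + y) - u x \<le> u y"
          by (intro u_ge) (simp add: algebra_simps)
        then show ?thesis by simp
      qed
      moreover have "u (t *\<^sub>R x) = t * u x" if "t \<ge> 0" for t x
      proof (cases "t = 0")
        case True
        have "u 0 = 0"
          unfolding u_def using False sub by (simp add: sublinear_zero)
        with True show ?thesis by simp
      next
        case t: False
        have "u (t *\<^sub>R x) / t \<le> u x"
          using u_le[of _ "t *\<^sub>R x"] sublinear_scale[OF sub that, of _ x] that t
          by (intro u_ge) (auto simp: field_simps)
        moreover have "t * u x \<le> u (t *\<^sub>R x)"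
          using u_le[of _ x] sublinear_scale[OF sub that, of _ x] that t
          by (intro u_ge) (metis mult_left_mono)
        ultimately show ?thesis using t that by (auto simp: field_simps)
      qed
      moreover have "u \<le> p"
      proof -
        obtain q where "q \<in> C" using False by auto
        then have "u x \<le> q x" "q x \<le> p x" for x
          using u_le C(1) by (auto simp: A_def le_fun_def)
        then show ?thesis by (meson le_funI order_trans)
      qed
      ultimately have "u \<in> A" by (simp add: A_def sublinear_def)
      with u_le show ?thesis by (auto simp: le_fun_def)
    qed
  qed
  then obtain q where "q \<in> A" "\<And>r. r \<in> A \<Longrightarrow> r \<le> q \<Longrightarrow> r = q"
    by blast
  then show ?thesis
    by (intro that[of q]) (auto simp: A_def le_fun_def intro: order_trans)
qed

text \<open>
  A minimal sublinear functional below \<open>p\<close> is linear, because \<open>sublinear_decrease\<close> cannot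
  make it smaller.
\<close>

theorem Hahn_Banach_sublinear:
  assumes p: "sublinear p"
  obtains f where "linear f" "\<And>x. f x \<le> p x" "f y = p y"
proof -
  \<comment> \<open>Lowering p at -y beforehand forces f(-y) \<le> - p(y), hence f(y) = p(y), for
    every linear f below p'.\<close>
  obtain p' where p': "sublinear p'" "\<And>x. p' x \<le> p x" "p' (- y) = - p y"
    using sublinear_decrease[OF p] by metis
  obtain q where q: "sublinear q" "\<And>x. q x \<le> p' x"
    and minimal: "\<And>r. sublinear r \<Longrightarrow> (\<And>x. r x \<le> q x) \<Longrightarrow> r = q"
    using minimal_sublinear_below[OF p'(1)] by metis
  have neg: "q (- x) = - q x" for x
    using sublinear_decrease[OF q(1), of x] minimal by metis
  have add: "q (x + z) = q x + q z" for x z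
    using sublinear_add[OF q(1), of x z] sublinear_add[OF q(1), of "- x" "- z"] neg[of "x + z"]
    by (simp add: neg)
  have "linear q"
  proof (rule linearI)
    show "q (t *\<^sub>R x) = t *\<^sub>R q x" for t x
      using sublinear_scale[OF q(1), of t x] sublinear_scale[OF q(1), of "- t" x] neg[of "t *\<^sub>R x"]
      by (cases "t \<ge> 0") auto
  qed (rule add)
  moreover have le: "q x \<le> p x" for x
    using q(2) p'(2) order_trans by blast
  moreover have "q y = p y"
    using q(2)[of "- y"] p'(3) neg[of y] le[of y] by simp
  ultimately show ?thesis by (rule that)
qed

text \<open>The distance to a subspace is the dominating functional for the separation below. Both
  estimates come from perturbing a near-optimal point of S within S.\<close>

lemma sublinear_infdist:
  fixes S :: "'a::real_normed_vector set"
  assumes S: "subspace S"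
  shows "sublinear (\<lambda>x. infdist x S)"
proof -
  have ne: "S \<noteq> {}" using subspace_0[OF S] by auto
  have le: "infdist x S \<le> norm (x - s)" if "s \<in> S" for x s
    using infdist_le[OF that, of x] by (simp add: dist_norm)
  have ge: "c \<le> infdist x S" if "\<And>s. s \<in> S \<Longrightarrow> c \<le> norm (x - s)" for c x
    unfolding infdist_def using ne that by (auto intro!: cINF_greatest simp: dist_norm)
  have "infdist (x + y) S \<le> infdist x S + infdist y S" for x y
  proof -
    have "infdist (x + y) S - norm (y - t) \<le> infdist x S" if "t \<in> S" for t
    proof (rule ge)
      fix s assume "s \<in> S"
      then have "infdist (x + y) S \<le> norm ((x - s) + (y - t))"
        using le[of "s + t" "x + y"] that S by (simp add: subspace_add algebra_simps)
      then show "infdist (x + y) S - norm (y - t) \<le> norm (x - s)"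
        using norm_triangle_ineq[of "x - s" "y - t"] by simp
    qed
    then have "infdist (x + y) S - infdist x S \<le> infdist y S"
      by (intro ge) (simp add: algebra_simps)
    then show ?thesis by simp
  qed
  moreover have "infdist (t *\<^sub>R x) S = t * infdist x S" if t: "t \<ge> 0" for t x
  proof (cases "t = 0")
    case True
    then show ?thesis using subspace_0[OF S] by simp
  next
    case False
    have half: "infdist (t *\<^sub>R x) S \<le> t * infdist x S" if "t > 0" for t x
    proof -
      have "infdist (t *\<^sub>R x) S / t \<le> infdist x S"
      proof (rule ge)
        fix s assume "s \<in> S"
        then have "infdist (t *\<^sub>R x) S \<le> norm (t *\<^sub>R (x - s))"
          using le[of "t *\<^sub>R s" "t *\<^sub>R x"] S by (simp add: subspace_scale algebra_simps)
        then show "infdist (t *\<^sub>R x) S / t \<le> norm (x - s)"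
          using that by (simp only: norm_scaleR) (simp add: divide_le_eq mult.commute)
      qed
      then show ?thesis using that by (simp add: field_simps)
    qed
    have "infdist (inverse t *\<^sub>R (t *\<^sub>R x)) S \<le> inverse t * infdist (t *\<^sub>R x) S"
      using t False by (intro half) auto
    with half[of t x] t False show ?thesis by (simp add: field_simps)
  qed
  ultimately show ?thesis by (simp add: sublinear_def)
qed

text \<open>Domination by the distance to S yields all conclusions at once: the distance is at most
  the norm, vanishes on S, and is positive at y because y lies off the closure.\<close>

corollary Hahn_Banach_separation:
  fixes S :: "'a::real_normed_vector set"
  assumes S: "subspace S" and y: "y \<notin> closure S"
  obtains f where "linear f" "\<And>x. \<bar>f x\<bar> \<le> norm x" "\<And>s. s \<in> S \<Longrightarrow> f s = 0" "f y > 0"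
proof -
  obtain f where f: "linear f" "\<And>x. f x \<le> infdist x S" "f y = infdist y S"
    using Hahn_Banach_sublinear[OF sublinear_infdist[OF S]] by metis
  have abs: "\<bar>f x\<bar> \<le> infdist x S" for x
  proof -
    have "infdist (- x) S \<le> infdist x S" for x
    proof -
      have "infdist (- x) S \<le> dist x s" if "s \<in> S" for s
        using infdist_le[of "- s" S "- x"] subspace_neg[OF S that] by (simp add: dist_minus)
      then show ?thesis
        using subspace_0[OF S] unfolding infdist_def[of x] by (auto intro!: cINF_greatest)
    qed
    then show ?thesis
      using f(2)[of x] f(2)[of "- x"] linear_neg[OF f(1), of x] by (smt (verit))
  qed
  show ?thesis
  proof (rule that[of f])
    show "\<bar>f x\<bar> \<le> norm x" for x
      using abs[of x] infdist_le[OF subspace_0[OF S], of x] by simp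
    show "f s = 0" if "s \<in> S" for s
      using abs[of s] that by simp
    show "f y > 0"
      using y f(3) infdist_nonneg[of y S] in_closure_iff_infdist_zero[of S y] subspace_0[OF S]
      by (auto simp: less_le)
  qed (rule f(1))
qed

section \<open>Riesz representation on a compact space\<close>

lemma Hausdorff_space_euclidean_t2: "Hausdorff_space (euclidean :: 'x::t2_space topology)"
  unfolding Hausdorff_space_def disjnt_def using hausdorff by (auto; meson)

lemma Urysohn_compact_UNIV:
  fixes S T :: "'x::t2_space set"
  assumes "compact (UNIV :: 'x set)" "closed S" "closed T" "S \<inter> T = {}"
  obtains u :: "'x \<Rightarrow> real" where "continuous_on UNIV u" "\<And>x. u x \<in> {0..1}"
    "\<And>x. x \<in> S \<Longrightarrow> u x = 0" "\<And>x. x \<in> T \<Longrightarrow> u x = 1"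
proof -
  have "normal_space (euclidean :: 'x topology)"
    using assms(1) Hausdorff_space_euclidean_t2
    by (intro compact_Hausdorff_or_regular_imp_normal_space) (auto simp: compact_space_def)
  then obtain u where "continuous_map (euclidean :: 'x topology) (top_of_set {0..1::real}) u"
    "u ` S \<subseteq> {0}" "u ` T \<subseteq> {1}"
    using assms Urysohn_lemma[of "euclidean :: 'x topology" S T 0 1] by (auto simp: disjnt_def)
  then show ?thesis
    by (intro that[of u]) (auto simp: continuous_map_in_subtopology)
qed

section \<open>A functional is determined by sandwiching on open sets\<close>

definition unit_function :: "('x::topological_space \<Rightarrow> real) \<Rightarrow> bool" where
  "unit_function g \<longleftrightarrow> continuous_on UNIV g \<and> (\<forall>x. 0 \<le> g x \<and> g x \<le> 1)"

lemma unit_function_bcontfun: "unit_function g \<Longrightarrow> g \<in> bcontfun"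
  by (rule bcontfun_normI[where b = 1]) (auto simp: unit_function_def)

text \<open>The axioms concern nonnegative functions only, since \<open>positive_part\<close> below
  is meaningful only there: if f takes a negative value, its supremum runs over the empty
  set.\<close>

locale cone_functional =
  fixes L :: "('x::topological_space \<Rightarrow> real) \<Rightarrow> real"
  assumes add: "\<lbrakk>f \<in> bcontfun; g \<in> bcontfun; \<And>x. 0 \<le> f x; \<And>x. 0 \<le> g x\<rbrakk> \<Longrightarrow> L (\<lambda>x. f x + g x) = L f + L g"
    and scale: "\<lbrakk>f \<in> bcontfun; \<And>x. 0 \<le> f x; 0 \<le> c\<rbrakk> \<Longrightarrow> L (\<lambda>x. c * f x) = c * L f"
    and nonneg: "\<lbrakk>f \<in> bcontfun; \<And>x. 0 \<le> f x\<rbrakk> \<Longrightarrow> 0 \<le> L f"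
begin

lemma zero: "L (\<lambda>x. 0) = 0"
  using scale[of "\<lambda>x. 0" 0] const_bcontfun[of 0] by simp

lemma mono:
  assumes "f \<in> bcontfun" "g \<in> bcontfun" "\<And>x. 0 \<le> f x" "\<And>x. f x \<le> g x"
  shows "L f \<le> L g"
proof -
  have g_f: "(\<lambda>x. g x - f x) \<in> bcontfun" "\<And>x. 0 \<le> g x - f x"
    using assms by (auto intro: minus_cont)
  then have "L (\<lambda>x. f x + (g x - f x)) = L f + L (\<lambda>x. g x - f x)"
    by (intro add assms)
  then show ?thesis using nonneg[OF g_f] by simp
qed

lemma sum:
  assumes "\<And>i. i < (n::nat) \<Longrightarrow> f i \<in> bcontfun" "\<And>i x. i < n \<Longrightarrow> 0 \<le> f i x"
  shows "L (\<lambda>x. \<Sum>i<n. f i x) = (\<Sum>i<n. L (f i))"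
  using assms
proof (induction n)
  case (Suc n)
  have sum: "(\<lambda>x. \<Sum>i<n. f i x) \<in> bcontfun"
    using Suc.prems(1) by (induction n) (auto intro: plus_cont const_bcontfun)
  show ?case
    using Suc add[OF sum, of "f n"] sum_nonneg[of "{..<n}" "\<lambda>i. f i _"] by simp
qed (simp add: zero)

end

text \<open>
  \<open>m\<close> is sandwiched by \<open>L\<close> if it behaves on open sets like a measure representing \<open>L\<close>.
  This already determines \<open>L\<close>: decompose \<open>f\<close> into horizontal slices of height \<open>1/n\<close>.
\<close>

definition sandwiched :: "(('x::topological_space \<Rightarrow> real) \<Rightarrow> real) \<Rightarrow> ('x set \<Rightarrow> real) \<Rightarrow> bool" where
  "sandwiched L m \<longleftrightarrow> (\<forall>g U. unit_function g \<longrightarrow> open U \<longrightarrow>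
     ((\<forall>x. x \<notin> U \<longrightarrow> g x = 0) \<longrightarrow> L g \<le> m U) \<and> ((\<forall>x\<in>U. g x = 1) \<longrightarrow> m U \<le> L g))"

lemma sum_slices:
  fixes y :: real
  assumes "0 \<le> y"
  shows "(\<Sum>i<n. min 1 (max 0 (y - real i))) = min (real n) y"
proof (induction n)
  case (Suc n)
  show ?case
    using Suc by (simp add: min_def max_def)
qed (use assms in simp)

text \<open>The slice \<open>g i\<close> of nf vanishes off \<open>U i\<close> and equals 1 on
  \<open>U (Suc i)\<close>, so L(g i) lies between m of these two sets. Summed over i, the two
  bounds for n L(f) differ by the telescoping term m(U 0) - m(U n), which is at most
  m(UNIV).\<close>

lemma (in cone_functional) layer_cake:
  assumes m: "sandwiched L m" and f: "unit_function f" and n: "n > 0"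
  shows "\<bar>L f - (\<Sum>i<n. m {x. real i < real n * f x}) / n\<bar> \<le> m UNIV / n"
proof -
  define g where "g = (\<lambda>i x. min 1 (max 0 (real n * f x - real i)))"
  define U where "U = (\<lambda>i. {x. real i < real n * f x})"
  have cont: "continuous_on UNIV f" and range: "0 \<le> f x" "f x \<le> 1" for x
    using f by (auto simp: unit_function_def)
  have g_unit: "unit_function (g i)" for i
    unfolding unit_function_def g_def by (auto intro!: continuous_intros cont)
  have U_open: "open (U i)" for i
    unfolding U_def by (intro open_Collect_less continuous_intros cont)
  have upper: "L (g i) \<le> m (U i)" for i
    using m[unfolded sandwiched_def, rule_format, OF g_unit[of i] U_open[of i]] by (auto simp: g_def U_def)
  have lower: "m (U (Suc i)) \<le> L (g i)" for i
    using m[unfolded sandwiched_def, rule_format, OF g_unit[of i] U_open[of "Suc i"]]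
    by (auto simp: g_def U_def)
  have "real n * f x \<le> real n" for x
    using range[of x] by (simp add: mult_left_le)
  then have "(\<Sum>i<n. g i x) = real n * f x" for x
    unfolding g_def using range[of x] by (subst sum_slices) (auto intro: min_absorb2)
  then have "(\<Sum>i<n. L (g i)) = L (\<lambda>x. real n * f x)"
    using sum[of n g] g_unit by (auto simp: unit_function_bcontfun) (auto simp: unit_function_def)
  also have "\<dots> = real n * L f"
    using scale[OF unit_function_bcontfun[OF f]] range by auto
  finally have L: "(\<Sum>i<n. L (g i)) = real n * L f" .
  have "(\<Sum>i<n. m (U (Suc i))) \<le> real n * L f" "real n * L f \<le> (\<Sum>i<n. m (U i))"
    unfolding L[symmetric] using upper lower by (auto intro!: sum_mono)
  moreover have "(\<Sum>i<n. m (U (Suc i))) = (\<Sum>i<n. m (U i)) + m (U n) - m (U 0)"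
    by (induction n) auto
  \<comment> \<open>Here m is an arbitrary set function; its monotonicity and sign where required
    are extracted from the sandwich with the constant functions 1 and 0.\<close>
  moreover have "m (U 0) \<le> m UNIV"
  proof -
    have one: "unit_function (\<lambda>_::'x. 1)" by (auto simp: unit_function_def)
    have "m (U 0) \<le> L (\<lambda>_. 1)" "L (\<lambda>_. 1) \<le> m UNIV"
      using m[unfolded sandwiched_def, rule_format, OF one] U_open by auto
    then show ?thesis by simp
  qed
  moreover have "0 \<le> m (U n)"
  proof -
    have "unit_function (\<lambda>_::'x. 0)" by (auto simp: unit_function_def)
    moreover have "U n = {}"
      using \<open>\<And>x. real n * f x \<le> real n\<close> by (auto simp: U_def not_less)
    ultimately show ?thesis
      using m[unfolded sandwiched_def, rule_format, of "\<lambda>_. 0" "{}"] zero by auto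
  qed
  ultimately have "\<bar>real n * L f - (\<Sum>i<n. m (U i))\<bar> \<le> m UNIV"
    by linarith
  then have "\<bar>real n * L f - (\<Sum>i<n. m (U i))\<bar> / n \<le> m UNIV / n"
    by (rule divide_right_mono) simp
  moreover have "L f - (\<Sum>i<n. m (U i)) / n = (real n * L f - (\<Sum>i<n. m (U i))) / n"
    using n by (simp add: field_simps)
  ultimately show ?thesis
    by (simp add: U_def abs_divide)
qed

text \<open>The approximating sum in \<open>layer_cake\<close> involves m and f but not the
  functional, so the two values differ by at most 2 m(UNIV) / n for every n. A general nonnegative f
  is scaled to a unit function.\<close>

lemma sandwiched_unique:
  assumes L: "cone_functional L" "sandwiched L m" and L': "cone_functional L'" "sandwiched L' m"
    and f: "f \<in> bcontfun" "\<And>x. 0 \<le> f x"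
  shows "L f = L' f"
proof -
  have unit: "L g = L' g" if g: "unit_function g" for g
  proof (rule ccontr)
    assume "L g \<noteq> L' g"
    then have pos: "\<bar>L g - L' g\<bar> > 0" by simp
    obtain n :: nat where "max 1 (2 * m UNIV / \<bar>L g - L' g\<bar>) < n"
      using reals_Archimedean2 by blast
    then have n: "n > 0" "2 * m UNIV / \<bar>L g - L' g\<bar> < n" by auto
    have "\<bar>L g - L' g\<bar> \<le> m UNIV / n + m UNIV / n"
      using cone_functional.layer_cake[OF L g n(1)] cone_functional.layer_cake[OF L' g n(1)]
      by linarith
    also have "\<dots> < \<bar>L g - L' g\<bar>"
      using n pos by (simp add: pos_divide_less_eq mult.commute)
    finally show False by simp
  qed
  have cont: "continuous_on UNIV f" and "bounded (range f)"
    using f(1) by (auto simp: bcontfun_def)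
  then obtain b where b: "\<And>x. norm (f x) \<le> b" "b > 0"
    unfolding bounded_pos by blast
  have "f x \<le> b" for x
    using b(1)[of x] by simp
  then have g: "unit_function (\<lambda>x. f x / b)"
    unfolding unit_function_def using f(2) b(2) by (auto intro!: continuous_intros cont)
  have "L (\<lambda>x. b * (f x / b)) = L' (\<lambda>x. b * (f x / b))"
    using cone_functional.scale[OF L(1) unit_function_bcontfun[OF g], of b]
      cone_functional.scale[OF L'(1) unit_function_bcontfun[OF g], of b] unit[OF g] f(2) b(2) by simp
  then show ?thesis using b(2) by simp
qed

lemma bcontfun_borel: "f \<in> bcontfun \<Longrightarrow> f \<in> borel_measurable borel"
  by (auto simp: bcontfun_def intro: borel_measurable_continuous_onI)

lemma integrable_bcontfun:
  fixes f :: "'x::topological_space \<Rightarrow> 'b::{banach,second_countable_topology}"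
  assumes "finite_measure \<mu>" "sets \<mu> = sets borel" "f \<in> bcontfun"
  shows "integrable \<mu> f"
proof -
  obtain b where "\<And>x. norm (f x) \<le> b"
    using assms(3) by (auto simp: bcontfun_def bounded_iff)
  moreover have "f \<in> borel_measurable \<mu>"
    using bcontfun_borel[OF assms(3)] assms(2) measurable_cong_sets by blast
  ultimately show ?thesis
    using assms(1) by (intro finite_measure.integrable_const_bound[where B = b]) auto
qed

lemma cone_functional_integral:
  assumes "finite_measure \<mu>" "sets \<mu> = sets borel"
  shows "cone_functional (\<lambda>f. LINT x|\<mu>. f x)"
  by unfold_locales
    (auto intro!: Bochner_Integration.integral_add Bochner_Integration.integral_nonneg
      integrable_bcontfun[OF assms])

lemma sandwiched_integral:
  fixes \<mu> :: "'x::topological_space measure"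
  assumes \<mu>: "finite_measure \<mu>" "sets \<mu> = sets borel"
  shows "sandwiched (\<lambda>f. LINT x|\<mu>. f x) (measure \<mu>)"
  unfolding sandwiched_def
proof (intro allI impI conjI)
  fix g :: "'x \<Rightarrow> real" and U :: "'x set" assume g: "unit_function g" and U: "open U"
  note int_g = integrable_bcontfun[OF \<mu> unit_function_bcontfun[OF g]]
  have U': "U \<in> sets \<mu>" using U \<mu>(2) by simp
  have int_U: "integrable \<mu> (indicator U :: 'x \<Rightarrow> real)"
    using U' \<mu>(1) by (auto intro: finite_measure.integrable_const_bound[where B = 1] simp: indicator_def)
  have U_eq: "measure \<mu> U = (LINT x|\<mu>. indicator U x)"
    using U' \<mu>(1) by (simp add: sets.sets_into_space Int_absorb2)
  show "(LINT x|\<mu>. g x) \<le> measure \<mu> U" if "\<forall>x. x \<notin> U \<longrightarrow> g x = 0"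
    unfolding U_eq using g that by (intro integral_mono int_g int_U) (auto simp: unit_function_def indicator_def)
  show "measure \<mu> U \<le> (LINT x|\<mu>. g x)" if "\<forall>x\<in>U. g x = 1"
    unfolding U_eq using g that by (intro integral_mono int_g int_U) (auto simp: unit_function_def indicator_def)
qed

section \<open>The representing measure of a positive functional, by Caratheodory's
  construction\<close>

locale compact_cone_functional = cone_functional L for L :: "('x::t2_space \<Rightarrow> real) \<Rightarrow> real" +
  assumes compact_UNIV: "compact (UNIV :: 'x set)"
begin

text \<open>Only vanishing off U is required; the closed support of g may reach the boundary of U.
  \<open>fits_closed\<close> makes up for this.\<close>

definition fits :: "('x \<Rightarrow> real) \<Rightarrow> 'x set \<Rightarrow> bool" where
  "fits g U \<longleftrightarrow> unit_function g \<and> (\<forall>x. x \<notin> U \<longrightarrow> g x = 0)"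

definition inner_content :: "'x set \<Rightarrow> ennreal" where
  "inner_content U = (SUP g\<in>{g. fits g U}. ennreal (L g))"

definition outer :: "'x set \<Rightarrow> ennreal" where
  "outer E = (INF U\<in>{U. open U \<and> E \<subseteq> U}. inner_content U)"

lemma L_unit_nonneg: "unit_function g \<Longrightarrow> 0 \<le> L g"
  by (intro nonneg unit_function_bcontfun) (auto simp: unit_function_def)

lemma L_unit_mono: "unit_function f \<Longrightarrow> unit_function g \<Longrightarrow> (\<And>x. f x \<le> g x) \<Longrightarrow> L f \<le> L g"
  by (intro mono unit_function_bcontfun) (auto simp: unit_function_def)

lemma L_unit_add: "unit_function f \<Longrightarrow> unit_function g \<Longrightarrow> L (\<lambda>x. f x + g x) = L f + L g"
  by (intro add unit_function_bcontfun) (auto simp: unit_function_def)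

lemma unit_const: "0 \<le> c \<Longrightarrow> c \<le> 1 \<Longrightarrow> unit_function (\<lambda>_::'x. c)"
  by (simp add: unit_function_def)

lemma inner_content_upper: "fits g U \<Longrightarrow> ennreal (L g) \<le> inner_content U"
  unfolding inner_content_def by (auto intro: SUP_upper)

lemma inner_content_mono: "U \<subseteq> V \<Longrightarrow> inner_content U \<le> inner_content V"
  unfolding inner_content_def by (intro SUP_subset_mono) (auto simp: fits_def)

lemma inner_content_le: "inner_content U \<le> ennreal (L (\<lambda>_. 1))"
  unfolding inner_content_def
  by (intro SUP_least ennreal_leI L_unit_mono unit_const) (auto simp: fits_def unit_function_def)

lemma fits_zero: "fits (\<lambda>_. 0) U"
  by (simp add: fits_def unit_const)

lemma inner_content_empty: "inner_content {} = 0"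
proof -
  have "g = (\<lambda>_. 0)" if "fits g {}" for g
    using that by (auto simp: fits_def)
  then have "L g = 0" if "fits g {}" for g
    using that zero by auto
  then show ?thesis
    unfolding inner_content_def by (intro antisym SUP_least) auto
qed

text \<open>Truncating \<open>g\<close> at a small height makes it vanish off a closed subset of \<open>U\<close>.\<close>

lemma fits_closed:
  assumes g: "fits g U" and e: "e > 0"
  obtains h K where "closed K" "K \<subseteq> U" "fits h K" "L g \<le> L h + e"
proof -
  \<comment> \<open>The quotient makes d L(1) \<le> e, with the added 1 guarding against division by
    zero; d \<le> 1 makes the constant d a unit function.\<close>
  define d where "d = min 1 (e / (L (\<lambda>_. 1) + 1))"
  have L1: "0 \<le> L (\<lambda>_. 1)" by (intro L_unit_nonneg unit_const) auto
  have d: "0 < d" "d \<le> 1" "d * L (\<lambda>_. 1) \<le> e"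
  proof -
    show "0 < d" "d \<le> 1" using e L1 by (auto simp: d_def)
    have "d * L (\<lambda>_. 1) \<le> e / (L (\<lambda>_. 1) + 1) * L (\<lambda>_. 1)"
      using L1 by (intro mult_right_mono) (auto simp: d_def)
    also have "\<dots> \<le> e" using L1 e by (simp add: field_simps)
    finally show "d * L (\<lambda>_. 1) \<le> e" .
  qed
  define h where "h = (\<lambda>x. max 0 (g x - d))"
  have cont: "continuous_on UNIV g" and range: "0 \<le> g x" "g x \<le> 1" for x
    using g by (auto simp: fits_def unit_function_def)
  have h: "unit_function h"
    unfolding h_def unit_function_def using range d by (auto intro!: continuous_intros cont)
      (smt (verit))
  have "L g \<le> L (\<lambda>x. h x + d)"
    using h d range g
    by (intro mono unit_function_bcontfun plus_cont const_bcontfun) (auto simp: fits_def h_def)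
  also have "\<dots> = L h + L (\<lambda>_. d)"
    using h d by (intro L_unit_add unit_const) auto
  also have "L (\<lambda>_. d) = d * L (\<lambda>_. 1)"
    using scale[of "\<lambda>_. 1" d] d const_bcontfun by auto
  finally have "L g \<le> L h + e" using d(3) by simp
  moreover have "closed {x. d \<le> g x}"
    by (intro closed_Collect_le continuous_intros cont)
  moreover have "{x. d \<le> g x} \<subseteq> U"
    using g d(1) by (auto simp: fits_def)
  moreover have "fits h {x. d \<le> g x}"
    using h by (auto simp: fits_def h_def)
  ultimately show ?thesis using that by blast
qed

text \<open>At the price of an arbitrarily small e, only functions vanishing off a closed, hence
  compact, subset of U need be tested.\<close>

lemma inner_content_leI:
  assumes "\<And>h K. closed K \<Longrightarrow> K \<subseteq> U \<Longrightarrow> fits h K \<Longrightarrow> ennreal (L h) \<le> c"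
  shows "inner_content U \<le> c"
  unfolding inner_content_def
proof (rule SUP_least)
  fix g assume "g \<in> {g. fits g U}"
  then have g: "fits g U" by simp
  show "ennreal (L g) \<le> c"
  proof (rule ennreal_le_epsilon)
    fix e :: real assume e: "e > 0"
    obtain h K where h: "closed K" "K \<subseteq> U" "fits h K" "L g \<le> L h + e"
      using fits_closed[OF g e] .
    have "ennreal (L g) \<le> ennreal (L h) + ennreal e"
      using h L_unit_nonneg[of h] e by (auto simp: fits_def simp flip: ennreal_plus intro: ennreal_leI)
    also have "\<dots> \<le> c + ennreal e"
      using assms[OF h(1-3)] by (rule add_right_mono)
    finally show "ennreal (L g) \<le> c + ennreal e" .
  qed
qed

lemma inner_content_Un:
  assumes "open U" "open V"
  shows "inner_content (U \<union> V) \<le> inner_content U + inner_content V"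
proof (rule inner_content_leI)
  fix h K assume K: "closed K" "K \<subseteq> U \<union> V" and h: "fits h K"
  \<comment> \<open>As K is covered by U and V, the closed sets K - U and K - V are disjoint.
    Multiplication by u and 1 - u splits h into a part vanishing off U and a part vanishing off
    V.\<close>
  obtain u :: "'x \<Rightarrow> real" where u: "continuous_on UNIV u" "\<And>x. u x \<in> {0..1}"
    "\<And>x. x \<in> K - U \<Longrightarrow> u x = 0" "\<And>x. x \<in> K - V \<Longrightarrow> u x = 1"
    using Urysohn_compact_UNIV[OF compact_UNIV, of "K - U" "K - V"] K assms
    by (auto simp: closed_Diff)
  have h': "continuous_on UNIV h" "\<And>x. 0 \<le> h x" "\<And>x. h x \<le> 1" "\<And>x. x \<notin> K \<Longrightarrow> h x = 0"
    using h by (auto simp: fits_def unit_function_def)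
  have "fits (\<lambda>x. h x * u x) U" "fits (\<lambda>x. h x * (1 - u x)) V"
    unfolding fits_def unit_function_def using h' u
    by (auto intro!: continuous_intros mult_le_one) metis+
  moreover have "h = (\<lambda>x. h x * u x + h x * (1 - u x))"
    by (auto simp: algebra_simps)
  ultimately have "L h = L (\<lambda>x. h x * u x) + L (\<lambda>x. h x * (1 - u x))"
    using L_unit_add[of "\<lambda>x. h x * u x" "\<lambda>x. h x * (1 - u x)"] by (simp add: fits_def)
  then have "ennreal (L h) = ennreal (L (\<lambda>x. h x * u x)) + ennreal (L (\<lambda>x. h x * (1 - u x)))"
    using \<open>fits _ U\<close> \<open>fits _ V\<close> by (simp add: ennreal_plus L_unit_nonneg fits_def)
  also have "\<dots> \<le> inner_content U + inner_content V"
    by (intro add_mono inner_content_upper) fact+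
  finally show "ennreal (L h) \<le> inner_content U + inner_content V" .
qed

text \<open>A function vanishing off a compact K sees only finitely many of the \<open>U i\<close>,
  which reduces countable to finite subadditivity.\<close>

lemma inner_content_UN:
  assumes "\<And>i. open (U i)"
  shows "inner_content (\<Union>i. U i) \<le> (\<Sum>i. inner_content (U i))"
proof (rule inner_content_leI)
  fix h K assume K: "closed K" "K \<subseteq> (\<Union>i. U i)" and h: "fits h K"
  have "compact K"
    using compact_UNIV K(1) compact_Int_closed[of UNIV K] by simp
  then obtain I where I: "finite I" "K \<subseteq> (\<Union>i\<in>I. U i)"
    using compactE_image[of K UNIV U] assms K(2) by auto
  obtain n where "I \<subseteq> {..<n}"
    using I(1) finite_nat_iff_bounded by auto
  with I h have "fits h (\<Union>i<n. U i)"
    by (auto simp: fits_def)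
  then have "ennreal (L h) \<le> inner_content (\<Union>i<n. U i)"
    by (rule inner_content_upper)
  also have "\<dots> \<le> (\<Sum>i<n. inner_content (U i))"
  proof (induction n)
    case (Suc n)
    have "inner_content (\<Union>i<Suc n. U i) \<le> inner_content (\<Union>i<n. U i) + inner_content (U n)"
      using inner_content_Un[of "\<Union>i<n. U i" "U n"] assms by (simp add: lessThan_Suc Un_commute open_UN)
    also have "\<dots> \<le> (\<Sum>i<Suc n. inner_content (U i))"
      using Suc by (simp add: add_right_mono)
    finally show ?case .
  qed (simp add: inner_content_empty)
  also have "\<dots> \<le> (\<Sum>i. inner_content (U i))"
    by (rule sum_le_suminf) auto
  finally show "ennreal (L h) \<le> (\<Sum>i. inner_content (U i))" .
qed

lemma outer_open: "open U \<Longrightarrow> outer U = inner_content U"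
  unfolding outer_def by (intro antisym INF_lower INF_greatest inner_content_mono) auto

lemma outer_le_inner_content: "open U \<Longrightarrow> E \<subseteq> U \<Longrightarrow> outer E \<le> inner_content U"
  unfolding outer_def by (intro INF_lower) auto

lemma outer_mono: "E \<subseteq> F \<Longrightarrow> outer E \<le> outer F"
  unfolding outer_def by (intro INF_superset_mono) auto

lemma outer_le: "outer E \<le> ennreal (L (\<lambda>_. 1))"
  using outer_mono[of E UNIV] outer_open[of UNIV] inner_content_le[of UNIV] by simp

lemma outer_approx:
  assumes "e > 0"
  obtains U where "open U" "E \<subseteq> U" "inner_content U \<le> outer E + e"
proof -
  have "outer E < outer E + e"
    using assms outer_le[of E] ennreal_add_left_cancel_less[of "outer E" 0 e] by (auto simp: top_unique)
  then show ?thesis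
    using that unfolding outer_def[of E] by (auto simp: INF_less_iff intro: less_imp_le)
qed

lemma outer_measure_space_outer: "outer_measure_space (Pow UNIV) outer"
proof -
  have "outer (\<Union>i. A i) \<le> (\<Sum>i. outer (A i))" for A :: "nat \<Rightarrow> 'x set"
  proof (rule ennreal_le_epsilon)
    fix e :: real assume e: "e > 0"
    have "\<exists>U. open U \<and> A i \<subseteq> U \<and> inner_content U \<le> outer (A i) + ennreal (e * (1/2) ^ Suc i)" for i
    proof -
      have "ennreal (e * (1/2) ^ Suc i) > 0" using e by simp
      then show ?thesis using outer_approx[of _ "A i"] by metis
    qed
    then obtain U where U: "open (U i)" "A i \<subseteq> U i"
      "inner_content (U i) \<le> outer (A i) + ennreal (e * (1/2) ^ Suc i)" for i
      by metis
    have "outer (\<Union>i. A i) \<le> inner_content (\<Union>i. U i)"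
      using U(1,2) by (intro outer_le_inner_content) (auto intro: UN_mono)
    also have "\<dots> \<le> (\<Sum>i. inner_content (U i))"
      by (rule inner_content_UN) (rule U(1))
    also have "\<dots> \<le> (\<Sum>i. outer (A i) + ennreal (e * (1/2) ^ Suc i))"
      by (intro suminf_le U(3)) auto
    also have "\<dots> = (\<Sum>i. outer (A i)) + (\<Sum>i. ennreal (e * (1/2) ^ Suc i))"
      by (intro suminf_add[symmetric]) auto
    also have "(\<Sum>i. ennreal (e * (1/2) ^ Suc i)) = ennreal e"
      using sums_mult[OF power_half_series, of e] e by (intro suminf_ennreal_eq) auto
    finally show "outer (\<Union>i. A i) \<le> (\<Sum>i. outer (A i)) + ennreal e" .
  qed
  then show ?thesis
    unfolding outer_measure_space_def positive_def increasing_def countably_subadditive_def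
    by (auto simp: outer_mono outer_open[of "{}"] inner_content_empty)
qed

text \<open>If h vanishes off K and g off W - K, they are never both nonzero, so h + g is still at
  most 1 and competes for the content of W. This superadditivity is the core of Caratheodory's
  condition for open sets.\<close>

lemma outer_Diff_closed:
  assumes W: "open W" and K: "closed K" "K \<subseteq> W" and h: "fits h K"
  shows "ennreal (L h) + inner_content (W - K) \<le> inner_content W"
proof -
  have "ennreal (L h) + ennreal (L g) \<le> inner_content W" if g: "fits g (W - K)" for g
  proof -
    have fits: "fits (\<lambda>x. h x + g x) W"
      unfolding fits_def unit_function_def
    proof (intro conjI allI impI)
      fix x
      show "h x + g x \<le> 1"
        using g h unfolding fits_def unit_function_def by (cases "x \<in> K") force+
    qed (use g h K(2) in \<open>auto simp: fits_def unit_function_def intro!: continuous_intros\<close>)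
    have "ennreal (L h) + ennreal (L g) = ennreal (L (\<lambda>x. h x + g x))"
      using g h by (simp add: fits_def L_unit_add ennreal_plus L_unit_nonneg)
    also have "\<dots> \<le> inner_content W"
      using fits by (rule inner_content_upper)
    finally show ?thesis .
  qed
  then have "(SUP g\<in>{g. fits g (W - K)}. ennreal (L h) + ennreal (L g)) \<le> inner_content W"
    by (intro SUP_least) auto
  then show ?thesis
    unfolding inner_content_def[of "W - K"] using fits_zero by (subst ennreal_SUP_add_right) auto
qed

text \<open>Covering E by an open W reduces the condition to W. Since W - U need not be open, it is
  enlarged to W - K, where K is a closed subset of W \<inter> U off which a near-optimal function
  vanishes.\<close>

lemma open_in_lambda_system:
  assumes U: "open U"
  shows "U \<in> lambda_system UNIV (Pow UNIV) outer"
proof -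
  interpret Pow: sigma_algebra UNIV "Pow UNIV :: 'x set set" by (rule sigma_algebra_Pow)
  have "subadditive (Pow UNIV) outer"
    using outer_measure_space_outer Pow.countably_subadditive_subadditive
    by (auto simp: outer_measure_space_def)
  then have sub: "outer E \<le> outer (E \<inter> U) + outer (E - U)" for E
    using subadditiveD[of "Pow UNIV" outer "E \<inter> U" "E - U"] by (simp add: Int_Diff_Un Int_Diff_disjoint)
  have "outer (E \<inter> U) + outer (E - U) \<le> inner_content W" if W: "open W" "E \<subseteq> W" for E W
  proof -
    have "ennreal (L g) + outer (W - U) \<le> inner_content W" if g: "fits g (W \<inter> U)" for g
    proof (rule ennreal_le_epsilon)
      fix e :: real assume e: "e > 0"
      obtain h K where h: "closed K" "K \<subseteq> W \<inter> U" "fits h K" "L g \<le> L h + e"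
        using fits_closed[OF g e] .
      have "ennreal (L g) \<le> ennreal (L h) + ennreal e"
        using h L_unit_nonneg[of h] e by (auto simp: fits_def simp flip: ennreal_plus intro: ennreal_leI)
      moreover have "outer (W - U) \<le> inner_content (W - K)"
        using h W(1) by (intro outer_le_inner_content) (auto simp: open_Diff)
      ultimately have "ennreal (L g) + outer (W - U) \<le> ennreal (L h) + ennreal e + inner_content (W - K)"
        by (rule add_mono)
      also have "\<dots> = ennreal (L h) + inner_content (W - K) + ennreal e"
        by (simp add: ac_simps)
      also have "\<dots> \<le> inner_content W + ennreal e"
        using h W(1) by (intro add_right_mono outer_Diff_closed) auto
      finally show "ennreal (L g) + outer (W - U) \<le> inner_content W + ennreal e" .
    qed
    then have "(SUP g\<in>{g. fits g (W \<inter> U)}. ennreal (L g) + outer (W - U)) \<le> inner_content W"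
      by (intro SUP_least) auto
    then have "inner_content (W \<inter> U) + outer (W - U) \<le> inner_content W"
      unfolding inner_content_def[of "W \<inter> U"] using fits_zero by (subst ennreal_SUP_add_left[symmetric]) auto
    moreover have "outer (E \<inter> U) \<le> inner_content (W \<inter> U)" "outer (E - U) \<le> outer (W - U)"
      using W U by (auto intro!: outer_mono outer_le_inner_content)
    ultimately show ?thesis
      by (meson add_mono order_trans)
  qed
  then have "outer (E \<inter> U) + outer (E - U) \<le> outer E" for E
    unfolding outer_def[of E] by (intro INF_greatest) auto
  with sub show ?thesis
    unfolding Pow.lambda_system_eq by (auto intro: antisym)
qed

definition representing_measure :: "'x measure" where
  "representing_measure = measure_of UNIV (sets borel) outer"

lemma sets_representing_measure: "sets representing_measure = sets borel"
  by (simp add: representing_measure_def sets.sigma_sets_eq[of borel, simplified])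

text \<open>By Caratheodory's theorem \<open>outer\<close> is a measure on its lambda system, which
  contains the open sets and therefore all Borel sets.\<close>

lemma emeasure_representing_measure:
  assumes "E \<in> sets borel"
  shows "emeasure representing_measure E = outer E"
proof -
  interpret Pow: sigma_algebra UNIV "Pow UNIV :: 'x set set" by (rule sigma_algebra_Pow)
  have ms: "measure_space UNIV (lambda_system UNIV (Pow UNIV) outer) outer"
    by (rule Pow.caratheodory_lemma[OF outer_measure_space_outer])
  then have "sigma_sets UNIV {U. open U} \<subseteq> lambda_system UNIV (Pow UNIV) outer"
    using open_in_lambda_system by (intro sigma_algebra.sigma_sets_subset) (auto simp: measure_space_def)
  then have "sets (borel :: 'x measure) \<subseteq> lambda_system UNIV (Pow UNIV) outer"
    by (simp add: borel_def)
  then have "countably_additive (sets (borel :: 'x measure)) outer"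
    using ms unfolding measure_space_def countably_additive_def by (metis sets.countable_UN subset_iff subset_trans top_greatest)
  then have "measure_space UNIV (sets (borel :: 'x measure)) outer"
    using ms sets.sigma_algebra_axioms[of "borel :: 'x measure"]
    by (simp add: measure_space_def positive_def)
  then show ?thesis
    unfolding representing_measure_def using assms
    by (intro emeasure_measure_of_sigma) (auto simp: measure_space_def)
qed

text \<open>Outer regularity holds by construction. Passing to complements turns it into inner
  regularity, because complements of open sets are compact and the total mass is finite.\<close>

lemma finite_radon_representing_measure: "finite_radon_measure representing_measure"
  unfolding finite_radon_measure_def
proof (intro conjI ballI sets_representing_measure)
  let ?\<mu> = representing_measure
  have space: "space ?\<mu> = UNIV"
    using sets_eq_imp_space_eq[OF sets_representing_measure] by simp
  show fin: "finite_measure ?\<mu>"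
    using outer_le[of UNIV] by (intro finite_measureI)
      (auto simp: space emeasure_representing_measure top_unique)
  fix B :: "'x set" assume B: "B \<in> sets borel"
  have add: "emeasure ?\<mu> A + emeasure ?\<mu> (- A) = emeasure ?\<mu> UNIV" if "A \<in> sets borel" for A
    using plus_emeasure[of A ?\<mu> "- A"] that borel_comp[OF that] by (simp add: sets_representing_measure)
  show "emeasure ?\<mu> B = (SUP K\<in>{K. compact K \<and> K \<subseteq> B}. emeasure ?\<mu> K)" (is "_ = ?S")
  proof (rule antisym)
    show "emeasure ?\<mu> B \<le> ?S"
    proof (rule ennreal_le_epsilon)
      fix e :: real assume e: "e > 0"
      obtain U where U: "open U" "- B \<subseteq> U" "inner_content U \<le> outer (- B) + e"
        using e by (auto intro: outer_approx[of "ennreal e" "- B"])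
      have "compact (- U)"
        using compact_Int_closed[OF compact_UNIV, of "- U"] U(1) by auto
      then have K: "emeasure ?\<mu> (- U) \<le> ?S"
        using U(2) by (intro SUP_upper) auto
      have "emeasure ?\<mu> (- B) + emeasure ?\<mu> B = emeasure ?\<mu> (- U) + emeasure ?\<mu> U"
        using add[OF B] add[of U] U(1) by (simp add: add.commute)
      also have "\<dots> \<le> ?S + (emeasure ?\<mu> (- B) + e)"
        using K U B borel_comp[OF B]
        by (intro add_mono) (auto simp: emeasure_representing_measure outer_open)
      also have "\<dots> = emeasure ?\<mu> (- B) + (?S + e)"
        by (simp add: ac_simps)
      finally show "emeasure ?\<mu> B \<le> ?S + e"
        using finite_measure.emeasure_finite[OF fin, of "- B"]
        by (simp add: ennreal_add_left_cancel_le)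
    qed
    show "?S \<le> emeasure ?\<mu> B"
      using B by (intro SUP_least emeasure_mono) (auto simp: sets_representing_measure)
  qed
qed

lemma sandwiched_representing_measure: "sandwiched L (measure representing_measure)"
  unfolding sandwiched_def
proof (intro allI impI conjI)
  fix g :: "'x \<Rightarrow> real" and U :: "'x set" assume g: "unit_function g" and U: "open U"
  have eq: "ennreal (measure representing_measure U) = inner_content U"
    using finite_radon_representing_measure U
    by (simp add: finite_radon_measure_def finite_measure.emeasure_eq_measure[symmetric]
        emeasure_representing_measure outer_open)
  show "L g \<le> measure representing_measure U" if "\<forall>x. x \<notin> U \<longrightarrow> g x = 0"
  proof -
    have "ennreal (L g) \<le> ennreal (measure representing_measure U)"
      unfolding eq using g that by (intro inner_content_upper) (auto simp: fits_def)
    then show ?thesis by (simp add: ennreal_le_iff)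
  qed
  show "measure representing_measure U \<le> L g" if "\<forall>x\<in>U. g x = 1"
  proof -
    have "ennreal (measure representing_measure U) \<le> ennreal (L g)"
      unfolding eq inner_content_def
    proof (rule SUP_least, rule ennreal_leI)
      fix h assume "h \<in> {h. fits h U}"
      then show "L h \<le> L g"
        using g that by (intro L_unit_mono) (auto simp: fits_def unit_function_def, metis)
    qed
    then show ?thesis using L_unit_nonneg[OF g] by (simp add: ennreal_le_iff)
  qed
qed

text \<open>L and the integral are both sandwiched by the same set function, so they agree on
  nonnegative functions.\<close>

theorem Riesz_representation:
  obtains \<mu> where "finite_radon_measure \<mu>"
    "\<And>f. f \<in> bcontfun \<Longrightarrow> (\<And>x. 0 \<le> f x) \<Longrightarrow> L f = (LINT x|\<mu>. f x)"
proof (rule that[OF finite_radon_representing_measure])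
  fix f :: "'x \<Rightarrow> real" assume f: "f \<in> bcontfun" "\<And>x. 0 \<le> f x"
  have "finite_measure representing_measure" "sets representing_measure = sets borel"
    using finite_radon_representing_measure by (auto simp: finite_radon_measure_def)
  with f show "L f = (LINT x|representing_measure. f x)"
    using sandwiched_unique[OF cone_functional_axioms sandwiched_representing_measure
        cone_functional_integral sandwiched_integral]
    by auto
qed

end

section \<open>From positive to signed functionals\<close>

lemma bcontfun_bound:
  fixes f :: "'x::topological_space \<Rightarrow> real"
  assumes "f \<in> bcontfun"
  obtains b where "b > 0" "\<And>x. \<bar>f x\<bar> \<le> b"
  using assms unfolding bcontfun_def bounded_pos by auto

lemma mult_const_bcontfun: "f \<in> bcontfun \<Longrightarrow> (\<lambda>x. c * f x) \<in> bcontfun" for c :: real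
  using scaleR_cont[of f c] by simp

lemma min_bcontfun:
  fixes f g :: "'x::topological_space \<Rightarrow> real"
  assumes "f \<in> bcontfun" "g \<in> bcontfun"
  shows "(\<lambda>x. min (f x) (g x)) \<in> bcontfun"
proof -
  obtain a b where "\<And>x. \<bar>f x\<bar> \<le> a" "\<And>x. \<bar>g x\<bar> \<le> b"
    using bcontfun_bound assms by metis
  then have "norm (min (f x) (g x)) \<le> max a b" for x
    by (smt (verit) real_norm_def)
  then show ?thesis
    using assms by (intro bcontfun_normI[of _ "max a b"]) (auto simp: bcontfun_def intro: continuous_intros)
qed

text \<open>The Riesz-Kantorovich formula for the positive part of \<phi> in the order dual.\<close>

definition positive_part :: "(('x::topological_space \<Rightarrow> real) \<Rightarrow> real) \<Rightarrow> ('x \<Rightarrow> real) \<Rightarrow> real" where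
  "positive_part \<phi> f = (SUP g\<in>{g \<in> bcontfun. \<forall>x. 0 \<le> g x \<and> g x \<le> f x}. \<phi> g)"

text \<open>The bound is phrased with any pointwise bound b, because the arguments are plain
  functions and carry no norm.\<close>

locale bounded_functional =
  fixes \<phi> :: "('x::topological_space \<Rightarrow> real) \<Rightarrow> real" and K :: real
  assumes add: "\<lbrakk>f \<in> bcontfun; g \<in> bcontfun\<rbrakk> \<Longrightarrow> \<phi> (\<lambda>x. f x + g x) = \<phi> f + \<phi> g"
    and scale: "f \<in> bcontfun \<Longrightarrow> \<phi> (\<lambda>x. c * f x) = c * \<phi> f"
    and bounded: "\<lbrakk>f \<in> bcontfun; \<And>x. \<bar>f x\<bar> \<le> b\<rbrakk> \<Longrightarrow> \<bar>\<phi> f\<bar> \<le> K * b"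
begin

lemma zero: "\<phi> (\<lambda>x. 0) = 0"
  using scale[of "\<lambda>x. 0" 0] const_bcontfun[of 0] by simp

lemma positive_part_upper:
  assumes "f \<in> bcontfun" "g \<in> bcontfun" "\<And>x. 0 \<le> g x" "\<And>x. g x \<le> f x"
  shows "\<phi> g \<le> positive_part \<phi> f"
  unfolding positive_part_def
proof (rule cSUP_upper)
  obtain b where "b > 0" "\<And>x. \<bar>f x\<bar> \<le> b" using bcontfun_bound[OF assms(1)] by blast
  then have "\<phi> h \<le> K * b" if "h \<in> bcontfun" "\<And>x. 0 \<le> h x" "\<And>x. h x \<le> f x" for h
    using bounded[OF that(1), of b] that(2,3) by (smt (verit))
  then show "bdd_above (\<phi> ` {g \<in> bcontfun. \<forall>x. 0 \<le> g x \<and> g x \<le> f x})"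
    by (intro bdd_aboveI2[of _ _ "K * b"]) auto
qed (use assms in auto)

lemma positive_part_least:
  assumes "\<And>x. 0 \<le> f x"
    and "\<And>g. \<lbrakk>g \<in> bcontfun; \<And>x. 0 \<le> g x; \<And>x. g x \<le> f x\<rbrakk> \<Longrightarrow> \<phi> g \<le> c"
  shows "positive_part \<phi> f \<le> c"
  unfolding positive_part_def
proof (rule cSUP_least)
  have "(\<lambda>_. 0) \<in> {g \<in> bcontfun. \<forall>x. 0 \<le> g x \<and> g x \<le> f x}"
    using assms(1) const_bcontfun by auto
  then show "{g \<in> bcontfun. \<forall>x. 0 \<le> g x \<and> g x \<le> f x} \<noteq> {}" by blast
qed (use assms in auto)

text \<open>Riesz decomposition: a g between 0 and f + h splits into min(g, f) and a remainder
  between 0 and h. The other inequality adds competitors for f and for h.\<close>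

lemma positive_part_add:
  assumes f: "f \<in> bcontfun" "\<And>x. 0 \<le> f x" and h: "h \<in> bcontfun" "\<And>x. 0 \<le> h x"
  shows "positive_part \<phi> (\<lambda>x. f x + h x) = positive_part \<phi> f + positive_part \<phi> h"
proof (rule antisym)
  show "positive_part \<phi> (\<lambda>x. f x + h x) \<le> positive_part \<phi> f + positive_part \<phi> h"
  proof (rule positive_part_least)
    fix g assume g: "g \<in> bcontfun" "\<And>x. 0 \<le> g x" "\<And>x. g x \<le> f x + h x"
    define u where "u = (\<lambda>x. min (g x) (f x))"
    have u: "u \<in> bcontfun" unfolding u_def using g f by (intro min_bcontfun)
    have "\<phi> u \<le> positive_part \<phi> f"
      using f g by (intro positive_part_upper u) (auto simp: u_def)
    moreover have "\<phi> (\<lambda>x. g x - u x) \<le> positive_part \<phi> h"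
      using f g h by (intro positive_part_upper minus_cont u) (auto simp: u_def min_def algebra_simps)
    moreover have "\<phi> g = \<phi> u + \<phi> (\<lambda>x. g x - u x)"
      using add[OF u minus_cont[OF g(1) u]] by simp
    ultimately show "\<phi> g \<le> positive_part \<phi> f + positive_part \<phi> h" by simp
  qed (use f h in auto)
next
  have *: "\<phi> u + \<phi> v \<le> positive_part \<phi> (\<lambda>x. f x + h x)"
    if "u \<in> bcontfun" "\<And>x. 0 \<le> u x" "\<And>x. u x \<le> f x" "v \<in> bcontfun" "\<And>x. 0 \<le> v x" "\<And>x. v x \<le> h x" for u v
    using positive_part_upper[of "\<lambda>x. f x + h x" "\<lambda>x. u x + v x"] that f h
    by (simp add: add plus_cont add_mono)
  have "positive_part \<phi> f \<le> positive_part \<phi> (\<lambda>x. f x + h x) - \<phi> v"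
    if "v \<in> bcontfun" "\<And>x. 0 \<le> v x" "\<And>x. v x \<le> h x" for v
    using *[OF _ _ _ that] f(2) by (intro positive_part_least) (auto simp: algebra_simps)
  then have "positive_part \<phi> h \<le> positive_part \<phi> (\<lambda>x. f x + h x) - positive_part \<phi> f"
    using h(2) by (intro positive_part_least) (auto simp: algebra_simps)
  then show "positive_part \<phi> f + positive_part \<phi> h \<le> positive_part \<phi> (\<lambda>x. f x + h x)" by simp
qed

lemma positive_part_scale:
  assumes f: "f \<in> bcontfun" "\<And>x. 0 \<le> f x" and c: "0 \<le> c"
  shows "positive_part \<phi> (\<lambda>x. c * f x) = c * positive_part \<phi> f"
proof (cases "c = 0")
  case True
  have "\<phi> g \<le> 0" if "\<And>x. 0 \<le> g x" "\<And>x. g x \<le> 0" for g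
  proof -
    have "g = (\<lambda>_. 0)" using that by (auto intro: antisym)
    then show ?thesis using zero by simp
  qed
  then have "positive_part \<phi> (\<lambda>_. 0) \<le> 0"
    by (intro positive_part_least) auto
  moreover have "\<phi> (\<lambda>_. 0) \<le> positive_part \<phi> (\<lambda>_. 0)"
    by (intro positive_part_upper const_bcontfun) auto
  ultimately have "positive_part \<phi> (\<lambda>_. 0) = 0"
    using zero by simp
  with True show ?thesis by simp
next
  case False
  have half: "c * positive_part \<phi> f \<le> positive_part \<phi> (\<lambda>x. c * f x)"
    if "c > 0" "f \<in> bcontfun" "\<And>x. 0 \<le> f x" for c f
  proof -
    have "positive_part \<phi> f \<le> positive_part \<phi> (\<lambda>x. c * f x) / c"
    proof (rule positive_part_least)
      fix g assume g: "g \<in> bcontfun" "\<And>x. 0 \<le> g x" "\<And>x. g x \<le> f x"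
      have "\<phi> (\<lambda>x. c * g x) \<le> positive_part \<phi> (\<lambda>x. c * f x)"
        using g that by (intro positive_part_upper mult_const_bcontfun) auto
      then show "\<phi> g \<le> positive_part \<phi> (\<lambda>x. c * f x) / c"
        using that g by (simp add: scale pos_le_divide_eq mult.commute)
    qed (rule that)
    then show ?thesis using that by (simp add: pos_le_divide_eq mult.commute)
  qed
  have "inverse c * positive_part \<phi> (\<lambda>x. c * f x) \<le> positive_part \<phi> (\<lambda>x. inverse c * (c * f x))"
    using c False f by (intro half mult_const_bcontfun) auto
  then have "positive_part \<phi> (\<lambda>x. c * f x) \<le> c * positive_part \<phi> f"
    using c False by (simp add: field_simps flip: mult.assoc)
  with half[of c f] f c False show ?thesis by simp
qed

lemma cone_functional_positive_part: "cone_functional (positive_part \<phi>)"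
proof
  show "0 \<le> positive_part \<phi> f" if "f \<in> bcontfun" "\<And>x. 0 \<le> f x" for f
    using positive_part_upper[OF that(1), of "\<lambda>_. 0"] that zero const_bcontfun by auto
qed (auto simp: positive_part_add positive_part_scale)

text \<open>The function f itself competes in the supremum defining
  \<open>positive_part \<phi> f\<close>, hence the difference is nonnegative.\<close>

lemma cone_functional_negative_part: "cone_functional (\<lambda>f. positive_part \<phi> f - \<phi> f)"
proof
  show "0 \<le> positive_part \<phi> f - \<phi> f" if "f \<in> bcontfun" "\<And>x. 0 \<le> f x" for f
    using positive_part_upper[OF that(1,1)] that by auto
qed (auto simp: positive_part_add positive_part_scale add scale algebra_simps)

end

theorem Riesz_representation_signed:
  fixes \<phi> :: "('x::t2_space \<Rightarrow> real) \<Rightarrow> real"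
  assumes compact: "compact (UNIV :: 'x set)" and \<phi>: "bounded_functional \<phi> K"
  obtains \<mu> \<nu> where "finite_radon_measure \<mu>" "finite_radon_measure \<nu>"
    "\<And>f. f \<in> bcontfun \<Longrightarrow> \<phi> f = (LINT x|\<mu>. f x) - (LINT x|\<nu>. f x)"
proof -
  interpret bounded_functional \<phi> K by fact
  interpret pos: compact_cone_functional "positive_part \<phi>"
    using compact cone_functional_positive_part
    by (simp add: compact_cone_functional_def compact_cone_functional_axioms_def)
  interpret neg: compact_cone_functional "\<lambda>f. positive_part \<phi> f - \<phi> f"
    using compact cone_functional_negative_part
    by (simp add: compact_cone_functional_def compact_cone_functional_axioms_def)
  obtain \<mu> where \<mu>: "finite_radon_measure \<mu>"
    "\<And>f. f \<in> bcontfun \<Longrightarrow> (\<And>x. 0 \<le> f x) \<Longrightarrow> positive_part \<phi> f = (LINT x|\<mu>. f x)"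
    using pos.Riesz_representation by blast
  obtain \<nu> where \<nu>: "finite_radon_measure \<nu>"
    "\<And>f. f \<in> bcontfun \<Longrightarrow> (\<And>x. 0 \<le> f x) \<Longrightarrow> positive_part \<phi> f - \<phi> f = (LINT x|\<nu>. f x)"
    using neg.Riesz_representation by blast
  have pos: "\<phi> f = (LINT x|\<mu>. f x) - (LINT x|\<nu>. f x)" if "f \<in> bcontfun" "\<And>x. 0 \<le> f x" for f
    using \<mu>(2)[OF that] \<nu>(2)[OF that] by simp
  have "\<phi> f = (LINT x|\<mu>. f x) - (LINT x|\<nu>. f x)" if f: "f \<in> bcontfun" for f
  proof -
    \<comment> \<open>A signed f is the difference of the nonnegative functions f + b and b, where
      the formula is known.\<close>
    obtain b where b: "b > 0" "\<And>x. \<bar>f x\<bar> \<le> b" using bcontfun_bound[OF f] by blast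
    have b_cont: "(\<lambda>_. b) \<in> bcontfun" by (rule const_bcontfun)
    have nonneg: "0 \<le> f x + b" for x using b(2)[of x] by simp
    have int: "integrable \<mu> f" "integrable \<nu> f" "integrable \<mu> (\<lambda>_. b)" "integrable \<nu> (\<lambda>_. b)"
      using \<mu>(1) \<nu>(1) f b_cont by (auto simp: finite_radon_measure_def intro: integrable_bcontfun)
    show ?thesis
      using pos[OF plus_cont[OF f b_cont] nonneg] pos[OF b_cont] b(1) add[OF f b_cont] int
      by simp
  qed
  with \<mu>(1) \<nu>(1) show ?thesis by (rule that)
qed

text \<open>An equality of differences of measures is written with sums, so that both sides are cone
  functionals and \<open>sandwiched_unique\<close> applies.\<close>

lemma integral_add_measures_cong:
  fixes f :: "'x::topological_space \<Rightarrow> real"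
  assumes fin: "\<And>\<mu>. \<mu> \<in> {\<mu>1, \<mu>2, \<mu>3, \<mu>4} \<Longrightarrow> finite_measure \<mu> \<and> sets \<mu> = sets borel"
    and eq: "\<And>E. E \<in> sets borel \<Longrightarrow> measure \<mu>1 E + measure \<mu>2 E = measure \<mu>3 E + measure \<mu>4 E"
    and f: "f \<in> bcontfun"
  shows "(LINT x|\<mu>1. f x) + (LINT x|\<mu>2. f x) = (LINT x|\<mu>3. f x) + (LINT x|\<mu>4. f x)"
proof -
  have cone: "cone_functional (\<lambda>f. (LINT x|\<mu>. f x) + (LINT x|\<nu>. f x))"
    if "\<mu> \<in> {\<mu>1, \<mu>2, \<mu>3, \<mu>4}" "\<nu> \<in> {\<mu>1, \<mu>2, \<mu>3, \<mu>4}" for \<mu> \<nu> :: "'x measure"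
  proof -
    interpret M: cone_functional "\<lambda>f. LINT x|\<mu>. f x" using fin[OF that(1)] by (intro cone_functional_integral) auto
    interpret N: cone_functional "\<lambda>f. LINT x|\<nu>. f x" using fin[OF that(2)] by (intro cone_functional_integral) auto
    show ?thesis
      by unfold_locales (simp_all only: M.add N.add M.scale N.scale M.nonneg N.nonneg algebra_simps add_nonneg_nonneg)
  qed
  have sandwiched: "sandwiched (\<lambda>f. (LINT x|\<mu>. f x) + (LINT x|\<nu>. f x)) (\<lambda>E. measure \<mu> E + measure \<nu> E)"
    if "\<mu> \<in> {\<mu>1, \<mu>2, \<mu>3, \<mu>4}" "\<nu> \<in> {\<mu>1, \<mu>2, \<mu>3, \<mu>4}" for \<mu> \<nu> :: "'x measure"
    using sandwiched_integral[of \<mu>] sandwiched_integral[of \<nu>] fin[OF that(1)] fin[OF that(2)]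
    unfolding sandwiched_def by (auto intro!: add_mono)
  \<comment> \<open>\<open>sandwiched\<close> evaluates its set function on open sets only, where
    \<open>eq\<close> permits the exchange.\<close>
  have "sandwiched (\<lambda>f. (LINT x|\<mu>3. f x) + (LINT x|\<mu>4. f x)) (\<lambda>E. measure \<mu>1 E + measure \<mu>2 E)"
    using sandwiched[of \<mu>3 \<mu>4] eq unfolding sandwiched_def by simp
  then have pos: "(LINT x|\<mu>1. g x) + (LINT x|\<mu>2. g x) = (LINT x|\<mu>3. g x) + (LINT x|\<mu>4. g x)"
    if "g \<in> bcontfun" "\<And>x. 0 \<le> g x" for g :: "'x \<Rightarrow> real"
    using sandwiched_unique[OF cone[of \<mu>1 \<mu>2] sandwiched[of \<mu>1 \<mu>2] cone[of \<mu>3 \<mu>4] _ that] by simp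
  obtain b where b: "b > 0" "\<And>x. \<bar>f x\<bar> \<le> b" using bcontfun_bound[OF f] by blast
  have b_cont: "(\<lambda>_::'x. b) \<in> bcontfun" by (rule const_bcontfun)
  have nonneg: "0 \<le> f x + b" for x using b(2)[of x] by simp
  have "integrable \<mu> f" "integrable \<mu> (\<lambda>_. b)" if "\<mu> \<in> {\<mu>1, \<mu>2, \<mu>3, \<mu>4}" for \<mu>
    using fin[OF that] f b_cont by (auto intro: integrable_bcontfun)
  then show ?thesis
    using pos[OF plus_cont[OF f b_cont] nonneg] pos[OF b_cont] b(1) by simp
qed

section \<open>Complex Radon measures\<close>

lemma finite_radon_measureD:
  assumes "finite_radon_measure \<mu>"
  shows "finite_measure \<mu>" "sets \<mu> = sets borel" "space \<mu> = UNIV"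
  using assms sets_eq_imp_space_eq[of \<mu> borel] by (auto simp: finite_radon_measure_def)

lemma finite_radon_measure_approx:
  assumes \<mu>: "finite_radon_measure \<mu>" and B: "B \<in> sets borel" and e: "e > 0"
  obtains K where "compact K" "K \<subseteq> B" "measure \<mu> (B - K) < e"
proof -
  interpret finite_measure \<mu> using \<mu> by (rule finite_radon_measureD)
  note sets = finite_radon_measureD(2)[OF \<mu>]
  have "\<exists>K. compact K \<and> K \<subseteq> B \<and> measure \<mu> B < measure \<mu> K + e"
  proof (cases "measure \<mu> B < e")
    \<comment> \<open>Split off because \<open>ennreal\<close> would truncate a negative
      \<open>measure \<mu> B - e\<close> to 0, and the strict inequality of the other case fails for
      a null set.\<close>
    case True
    then show ?thesis by (intro exI[of _ "{}"]) auto
  next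
    case False
    then have "ennreal (measure \<mu> B - e) < emeasure \<mu> B"
      using e by (simp add: emeasure_eq_measure ennreal_less_iff)
    also have "\<dots> = (SUP K\<in>{K. compact K \<and> K \<subseteq> B}. emeasure \<mu> K)"
      using \<mu> B by (simp add: finite_radon_measure_def)
    finally obtain K where "compact K" "K \<subseteq> B" "ennreal (measure \<mu> B - e) < emeasure \<mu> K"
      by (auto simp: less_SUP_iff)
    with False show ?thesis
      by (intro exI[of _ K]) (auto simp: emeasure_eq_measure ennreal_less_iff)
  qed
  then obtain K where K: "compact K" "K \<subseteq> B" "measure \<mu> B < measure \<mu> K + e" by auto
  then have "measure \<mu> (B - K) = measure \<mu> B - measure \<mu> K"
    using B by (intro finite_measure_Diff) (auto simp: sets compact_imp_closed)
  with K show ?thesis by (intro that[of K]) auto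
qed

text \<open>Inner regularity is inherited under domination: a compact K with \<mu>(B - K) < e also
  has \<nu>(B - K) \<le> e.\<close>

lemma finite_radon_measure_le:
  assumes \<mu>: "finite_radon_measure \<mu>" and sets: "sets \<nu> = sets borel"
    and le: "\<And>E. E \<in> sets borel \<Longrightarrow> emeasure \<nu> E \<le> emeasure \<mu> E"
  shows "finite_radon_measure \<nu>"
  unfolding finite_radon_measure_def
proof (intro conjI ballI sets)
  have space: "space \<nu> = UNIV" using sets_eq_imp_space_eq[OF sets] by simp
  show fin: "finite_measure \<nu>"
    using le[of UNIV] finite_measure.emeasure_finite[OF finite_radon_measureD(1)[OF \<mu>], of UNIV]
    by (intro finite_measureI) (auto simp: space top_unique)
  fix B :: "'a set" assume B: "B \<in> sets borel"
  show "emeasure \<nu> B = (SUP K\<in>{K. compact K \<and> K \<subseteq> B}. emeasure \<nu> K)" (is "_ = ?S")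
  proof (rule antisym)
    show "emeasure \<nu> B \<le> ?S"
    proof (rule ennreal_le_epsilon)
      fix e :: real assume "e > 0"
      then obtain K where K: "compact K" "K \<subseteq> B" "measure \<mu> (B - K) < e"
        using finite_radon_measure_approx[OF \<mu> B] by blast
      have K_borel: "K \<in> sets borel" using K(1) by (simp add: compact_imp_closed)
      have "emeasure \<nu> B = emeasure \<nu> K + emeasure \<nu> (B - K)"
        using K(2) K_borel B by (subst plus_emeasure) (auto simp: sets Un_absorb1)
      also have "emeasure \<nu> (B - K) \<le> emeasure \<mu> (B - K)"
        using K_borel B by (intro le) auto
      also have "\<dots> \<le> ennreal e"
        using K(3) finite_radon_measureD(1)[OF \<mu>]
        by (simp add: finite_measure.emeasure_eq_measure ennreal_leI)
      also have "emeasure \<nu> K \<le> ?S"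
        using K by (intro SUP_upper) auto
      finally show "emeasure \<nu> B \<le> ?S + ennreal e"
        by (simp add: add_mono)
    qed
    show "?S \<le> emeasure \<nu> B"
      using B by (intro SUP_least emeasure_mono) (auto simp: sets)
  qed
qed

section \<open>Jordan decomposition and differences of Radon measures\<close>

definition countably_additive_real :: "('x::topological_space set \<Rightarrow> real) \<Rightarrow> bool" where
  "countably_additive_real \<nu> \<longleftrightarrow>
     (\<forall>A. range A \<subseteq> sets borel \<longrightarrow> disjoint_family A \<longrightarrow> (\<lambda>n::nat. \<nu> (A n)) sums \<nu> (\<Union>n. A n))"

lemma countably_additive_realD:
  "countably_additive_real \<nu> \<Longrightarrow> range A \<subseteq> sets borel \<Longrightarrow> disjoint_family A \<Longrightarrow>
    (\<lambda>n::nat. \<nu> (A n)) sums \<nu> (\<Union>n. A n)"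
  by (simp add: countably_additive_real_def)

lemma countably_additive_real_uminus: "countably_additive_real \<nu> \<Longrightarrow> countably_additive_real (\<lambda>E. - \<nu> E)"
  unfolding countably_additive_real_def by (auto intro: sums_minus)

lemma countably_additive_real_empty:
  assumes "countably_additive_real \<nu>"
  shows "\<nu> {} = 0"
proof -
  have "(\<lambda>n::nat. \<nu> {}) sums \<nu> {}"
    using countably_additive_realD[OF assms, of "\<lambda>_. {}"] by (simp add: disjoint_family_on_def)
  then show ?thesis
    using summable_const_iff sums_summable by blast
qed

lemma countably_additive_real_Diff:
  assumes \<nu>: "countably_additive_real \<nu>" and A: "A \<in> sets borel" "E \<in> sets borel" "A \<subseteq> E"
  shows "\<nu> E = \<nu> A + \<nu> (E - A)"
proof -
  have "(\<lambda>n. \<nu> (binaryset A (E - A) n)) sums \<nu> (\<Union>n. binaryset A (E - A) n)"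
    using A by (intro countably_additive_realD[OF \<nu>]) (auto simp: binaryset_def disjoint_family_on_def)
  moreover have "(\<lambda>n. \<nu> (binaryset A (E - A) n)) sums (\<nu> A + \<nu> (E - A))"
    using binaryset_sums[of \<nu> A "E - A"] countably_additive_real_empty[OF \<nu>] by simp
  moreover have "(\<Union>n. binaryset A (E - A) n) = E"
    using A(3) by (auto simp: UN_binaryset_eq)
  ultimately show ?thesis
    using sums_unique2 by metis
qed

lemma sets_pos_variation: "sets (pos_variation \<nu>) = sets borel"
  by (simp add: pos_variation_def sets.sigma_sets_eq[of borel, simplified])

lemma
  assumes \<nu>: "countably_additive_real \<nu>" and fin: "finite_measure (pos_variation \<nu>)" and E: "E \<in> sets borel"
  shows measure_pos_variation_upper: "A \<in> sets borel \<Longrightarrow> A \<subseteq> E \<Longrightarrow> \<nu> A \<le> measure (pos_variation \<nu>) E"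
    and measure_pos_variation_least:
      "(\<And>A. A \<in> sets borel \<Longrightarrow> A \<subseteq> E \<Longrightarrow> \<nu> A \<le> c) \<Longrightarrow> measure (pos_variation \<nu>) E \<le> c"
proof -
  interpret finite_measure "pos_variation \<nu>" by fact
  have eq: "ennreal (measure (pos_variation \<nu>) E) = (SUP A\<in>{A \<in> sets borel. A \<subseteq> E}. ennreal (\<nu> A))"
    using emeasure_pos_variation[OF countably_additive_realD[OF \<nu>] E] by (simp add: emeasure_eq_measure)
  show "\<nu> A \<le> measure (pos_variation \<nu>) E" if "A \<in> sets borel" "A \<subseteq> E"
  proof -
    have "ennreal (\<nu> A) \<le> ennreal (measure (pos_variation \<nu>) E)"
      unfolding eq using that by (intro SUP_upper) auto
    then show ?thesis by (simp add: ennreal_le_iff)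
  qed
  assume le: "\<And>A. A \<in> sets borel \<Longrightarrow> A \<subseteq> E \<Longrightarrow> \<nu> A \<le> c"
  \<comment> \<open>The competitor \<open>A = {}\<close> gives this; only for nonnegative c can the
    bound by \<open>ennreal c\<close> be read back in the reals.\<close>
  then have "0 \<le> c"
    using le[of "{}"] countably_additive_real_empty[OF \<nu>] by simp
  moreover have "ennreal (measure (pos_variation \<nu>) E) \<le> ennreal c"
    unfolding eq using le by (intro SUP_least ennreal_leI) auto
  ultimately show "measure (pos_variation \<nu>) E \<le> c" by simp
qed

text \<open>For A \<subseteq> E, \<nu>(A) = \<nu>(E) - \<nu>(E - A) is at most \<nu>(E) plus the
  negative variation of E; the supremum over A gives one inequality, and the same argument for
  -\<nu> the other. No Hahn decomposition into a positive and a negative set enters.\<close>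

lemma Jordan_decomposition:
  assumes \<nu>: "countably_additive_real \<nu>" and fin: "finite_measure (pos_variation \<nu>)"
    "finite_measure (neg_variation \<nu>)" and E: "E \<in> sets borel"
  shows "\<nu> E = measure (pos_variation \<nu>) E - measure (neg_variation \<nu>) E"
proof (rule antisym)
  note upper = measure_pos_variation_upper[OF \<nu> fin(1) E]
    measure_pos_variation_upper[OF countably_additive_real_uminus[OF \<nu>] fin(2)[unfolded neg_variation_def] E,
      folded neg_variation_def]
  note least = measure_pos_variation_least[OF \<nu> fin(1) E]
    measure_pos_variation_least[OF countably_additive_real_uminus[OF \<nu>] fin(2)[unfolded neg_variation_def] E,
      folded neg_variation_def]
  have "\<nu> A \<le> \<nu> E + measure (neg_variation \<nu>) E" if "A \<in> sets borel" "A \<subseteq> E" for A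
    using upper(2)[of "E - A"] countably_additive_real_Diff[OF \<nu> that(1) E that(2)] that E by auto
  from least(1)[OF this] show "measure (pos_variation \<nu>) E - measure (neg_variation \<nu>) E \<le> \<nu> E" by simp
  have "- \<nu> A \<le> measure (pos_variation \<nu>) E - \<nu> E" if "A \<in> sets borel" "A \<subseteq> E" for A
    using upper(1)[of "E - A"] countably_additive_real_Diff[OF \<nu> that(1) E that(2)] that E by auto
  from least(2)[OF this] show "\<nu> E \<le> measure (pos_variation \<nu>) E - measure (neg_variation \<nu>) E" by simp
qed

context
  fixes \<mu>1 \<mu>2 :: "'x::t2_space measure" and \<nu>
  assumes \<mu>1: "finite_radon_measure \<mu>1" and \<mu>2: "finite_radon_measure \<mu>2"
  defines "\<nu> \<equiv> \<lambda>E. measure \<mu>1 E - measure \<mu>2 E"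
begin

lemma countably_additive_real_difference: "countably_additive_real \<nu>"
  unfolding countably_additive_real_def
proof (intro allI impI)
  fix A :: "nat \<Rightarrow> 'x set" assume A: "range A \<subseteq> sets borel" "disjoint_family A"
  have "(\<lambda>n. measure \<mu> (A n)) sums measure \<mu> (\<Union>n. A n)" if "finite_radon_measure \<mu>" for \<mu>
    using finite_measure.finite_measure_UNION[OF finite_radon_measureD(1)[OF that]]
      A finite_radon_measureD(2)[OF that] by auto
  then show "(\<lambda>n. \<nu> (A n)) sums \<nu> (\<Union>n. A n)"
    unfolding \<nu>_def using \<mu>1 \<mu>2 by (intro sums_diff)
qed

text \<open>For A \<subseteq> E, \<nu>(A) \<le> \<mu>1(A) \<le> \<mu>1(E), so the positive variation
  is dominated by the Radon measure \<mu>1.\<close>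

lemma finite_radon_pos_variation_difference: "finite_radon_measure (pos_variation \<nu>)"
proof (rule finite_radon_measure_le[OF \<mu>1 sets_pos_variation])
  fix E :: "'x set" assume E: "E \<in> sets borel"
  have fin: "finite_measure \<mu>1" "sets \<mu>1 = sets borel" using finite_radon_measureD[OF \<mu>1] by auto
  have "ennreal (\<nu> A) \<le> emeasure \<mu>1 E" if A: "A \<in> sets borel" "A \<subseteq> E" for A
  proof -
    have "ennreal (\<nu> A) \<le> ennreal (measure \<mu>1 A)"
      by (intro ennreal_leI) (simp add: \<nu>_def)
    also have "\<dots> \<le> emeasure \<mu>1 E"
      using A E fin by (simp add: finite_measure.emeasure_eq_measure[symmetric] emeasure_mono)
    finally show ?thesis .
  qed
  then show "emeasure (pos_variation \<nu>) E \<le> emeasure \<mu>1 E"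
    using emeasure_pos_variation[OF countably_additive_realD[OF countably_additive_real_difference] E]
    by (auto intro: SUP_least)
qed

end

lemma finite_radon_neg_variation_difference:
  assumes "finite_radon_measure \<mu>1" "finite_radon_measure \<mu>2"
  shows "finite_radon_measure (neg_variation (\<lambda>E. measure \<mu>1 E - measure \<mu>2 E))"
  using finite_radon_pos_variation_difference[OF assms(2,1)] by (simp add: neg_variation_def)

lemma Re_bcontfun: "F \<in> bcontfun \<Longrightarrow> (\<lambda>x. Re (F x)) \<in> bcontfun"
  and Im_bcontfun: "F \<in> bcontfun \<Longrightarrow> (\<lambda>x. Im (F x)) \<in> bcontfun"
  unfolding bcontfun_def bounded_iff
  by (auto intro!: continuous_intros) (meson abs_Re_le_cmod abs_Im_le_cmod order_trans)+

text \<open>The Jordan variations may differ from \<mu>1 and \<mu>2, but positive variation + \<mu>2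
  = negative variation + \<mu>1 as measures. The integrals of the real and imaginary parts of F obey
  the same identity.\<close>

lemma signed_integral_difference:
  fixes F :: "'x::t2_space \<Rightarrow> complex"
  assumes \<mu>: "finite_radon_measure \<mu>1" "finite_radon_measure \<mu>2" and F: "F \<in> bcontfun"
  shows "signed_integral (\<lambda>E. measure \<mu>1 E - measure \<mu>2 E) F = (LINT x|\<mu>1. F x) - (LINT x|\<mu>2. F x)"
proof -
  define \<nu> where "\<nu> = (\<lambda>E. measure \<mu>1 E - measure \<mu>2 E)"
  note \<nu> = countably_additive_real_difference[OF \<mu>, folded \<nu>_def]
  note fin = finite_radon_measureD[OF finite_radon_pos_variation_difference[OF \<mu>, folded \<nu>_def]]
    finite_radon_measureD[OF finite_radon_neg_variation_difference[OF \<mu>, folded \<nu>_def]]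
    finite_radon_measureD[OF \<mu>(1)] finite_radon_measureD[OF \<mu>(2)]
  have "measure (pos_variation \<nu>) E + measure \<mu>2 E = measure (neg_variation \<nu>) E + measure \<mu>1 E"
    if "E \<in> sets borel" for E
    using Jordan_decomposition[OF \<nu> fin(1,4) that] by (simp add: \<nu>_def)
  then have real: "(LINT x|pos_variation \<nu>. f x) + (LINT x|\<mu>2. f x)
      = (LINT x|neg_variation \<nu>. f x) + (LINT x|\<mu>1. f x)"
    if "f \<in> bcontfun" for f :: "'x \<Rightarrow> real"
    using that fin by (intro integral_add_measures_cong) auto
  have "(LINT x|pos_variation \<nu>. F x) + (LINT x|\<mu>2. F x) = (LINT x|neg_variation \<nu>. F x) + (LINT x|\<mu>1. F x)"
  proof -
    have int: "integrable \<mu> F" if "\<mu> \<in> {pos_variation \<nu>, neg_variation \<nu>, \<mu>1, \<mu>2}" for \<mu>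
      using that fin F by (auto intro: integrable_bcontfun)
    show ?thesis
      using real[OF Re_bcontfun[OF F]] real[OF Im_bcontfun[OF F]] int by (intro complex_eqI) simp_all
  qed
  then show ?thesis
    unfolding signed_integral_def \<nu>_def[symmetric] by (simp add: algebra_simps)
qed

text \<open>Both the Riesz representation and the point evaluations obtain their complex Radon
  measures from this construction.\<close>

lemma complex_radon_measure_four:
  fixes \<mu>1 \<mu>2 \<mu>3 \<mu>4 :: "'x::t2_space measure"
  assumes \<mu>: "finite_radon_measure \<mu>1" "finite_radon_measure \<mu>2" "finite_radon_measure \<mu>3" "finite_radon_measure \<mu>4"
  defines "\<sigma> \<equiv> \<lambda>E. Complex (measure \<mu>1 E - measure \<mu>2 E) (measure \<mu>3 E - measure \<mu>4 E)"
  shows "complex_radon_measure \<sigma>"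
    and "F \<in> bcontfun \<Longrightarrow> complex_integral \<sigma> F =
      (LINT x|\<mu>1. F x) - (LINT x|\<mu>2. F x) + \<i> * ((LINT x|\<mu>3. F x) - (LINT x|\<mu>4. F x))"
proof -
  have "complex_borel_measure \<sigma>"
    unfolding complex_borel_measure_def \<sigma>_def
  proof (intro allI impI)
    fix A :: "nat \<Rightarrow> 'x set" assume A: "range A \<subseteq> sets borel" "disjoint_family A"
    note sums = countably_additive_realD[OF countably_additive_real_difference A]
    show "(\<lambda>n. Complex (measure \<mu>1 (A n) - measure \<mu>2 (A n)) (measure \<mu>3 (A n) - measure \<mu>4 (A n))) sums
        Complex (measure \<mu>1 (\<Union>n. A n) - measure \<mu>2 (\<Union>n. A n)) (measure \<mu>3 (\<Union>n. A n) - measure \<mu>4 (\<Union>n. A n))"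
      unfolding sums_complex_iff complex.sel using sums[OF \<mu>(1,2)] sums[OF \<mu>(3,4)] by (rule conjI)
  qed
  then show "complex_radon_measure \<sigma>"
    unfolding complex_radon_measure_def \<sigma>_def
    by (simp add: finite_radon_pos_variation_difference finite_radon_neg_variation_difference \<mu>)
  show "complex_integral \<sigma> F =
      (LINT x|\<mu>1. F x) - (LINT x|\<mu>2. F x) + \<i> * ((LINT x|\<mu>3. F x) - (LINT x|\<mu>4. F x))" if "F \<in> bcontfun"
    unfolding complex_integral_def \<sigma>_def by (simp add: signed_integral_difference \<mu> that)
qed

section \<open>Functionals on left uniformly continuous functions\<close>

text \<open>The bound on 1 - F makes 1 - F admissible in the tail estimate
  \<open>complex_integral_small_off_compact\<close>.\<close>

lemma Urysohn_compact_support: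
  fixes K U :: "'x::t2_space set"
  assumes lc: "locally_compact_space (euclidean :: 'x topology)"
    and K: "compact K" and U: "open U" "K \<subseteq> U"
  obtains F :: "'x \<Rightarrow>\<^sub>C complex" and C where "compact C" "\<And>x. x \<notin> C \<Longrightarrow> F x = 0"
    "\<And>x. x \<notin> U \<Longrightarrow> F x = 0" "\<And>x. x \<in> K \<Longrightarrow> F x = 1" "\<And>x. cmod (1 - F x) \<le> 1"
proof -
  have "regular_space (euclidean :: 'x topology)"
    using lc locally_compact_Hausdorff_imp_regular_space Hausdorff_space_euclidean_t2 by blast
  then have cr: "completely_regular_space (euclidean :: 'x topology)"
    using lc locally_compact_regular_imp_completely_regular_space by blast
  have "\<forall>K :: 'x set. compact K \<longrightarrow> (\<exists>V C. open V \<and> compact C \<and> closed C \<and> K \<subseteq> V \<and> V \<subseteq> C)"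
    using lc locally_compact_space_compact_closed_compact[of "euclidean :: 'x topology"]
    by (simp add: Hausdorff_space_euclidean_t2)
  from this[rule_format, OF K] obtain V C where V: "open V" "compact C" "K \<subseteq> V" "V \<subseteq> C"
    by (elim exE conjE) (rule that)
  \<comment> \<open>Vanishing off V \<inter> U serves both demands: vanishing off the given U, and
    off the compact C that contains V.\<close>
  have "closedin euclidean (- (V \<inter> U))" "disjnt K (- (V \<inter> U))"
    using V U by (auto simp: disjnt_def)
  then obtain f where f: "continuous_map (euclidean :: 'x topology) (top_of_set {0..1::real}) f"
    "f ` (- (V \<inter> U)) \<subseteq> {0}" "f ` K \<subseteq> {1}"
    using Urysohn_completely_regular_compact_closed[of 0 1 "euclidean :: 'x topology" K "- (V \<inter> U)"] cr K
    by auto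
  then have f': "continuous_on UNIV f" "\<And>x. 0 \<le> f x" "\<And>x. f x \<le> 1"
    by (auto simp: continuous_map_in_subtopology)
  then have "(\<lambda>x. complex_of_real (f x)) \<in> bcontfun"
    by (intro bcontfun_normI[of _ 1]) (auto intro!: continuous_intros)
  then obtain F where "(\<lambda>x. complex_of_real (f x)) = apply_bcontfun F"
    by (rule bcontfunE)
  then have F: "F x = of_real (f x)" for x by metis
  show ?thesis
  proof (rule that[of C F])
    show "cmod (1 - F x) \<le> 1" for x
    proof -
      have "1 - F x = of_real (1 - f x)" by (simp add: F)
      then have "cmod (1 - F x) = \<bar>1 - f x\<bar>" by (simp only: norm_of_real)
      then show ?thesis using f'(2,3)[of x] by simp
    qed
    show "F x = 0" if "x \<notin> C" for x
    proof -
      have "x \<in> - (V \<inter> U)" using V(4) that by auto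
      then show ?thesis using f(2) by (simp add: F image_subset_iff)
    qed
    show "F x = 0" if "x \<notin> U" for x
      using f(2) that by (simp add: F image_subset_iff)
    show "F x = 1" if "x \<in> K" for x
      using f(3) that by (simp add: F image_subset_iff)
  qed (rule V)
qed

lemma norm_cscale: "norm (cscale c F) = cmod c * norm F" for F :: "'x::topological_space \<Rightarrow>\<^sub>C complex"
proof (cases "c = 0")
  case True
  then have "cscale c F = 0" by (intro bcontfun_eqI) (simp add: apply_cscale)
  with True show ?thesis by simp
next
  case False
  have le: "norm (cscale c F) \<le> cmod c * norm F" for c and F :: "'x \<Rightarrow>\<^sub>C complex"
    by (rule norm_bound) (auto simp: apply_cscale norm_mult intro!: mult_left_mono norm_bounded)
  have "cscale (inverse c) (cscale c F) = F"
    using False by (intro bcontfun_eqI) (simp add: apply_cscale)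
  then have "norm F \<le> inverse (cmod c) * norm (cscale c F)"
    using le[of "inverse c" "cscale c F"] by (simp add: norm_inverse)
  then have "cmod c * norm F \<le> norm (cscale c F)"
    using False by (simp add: field_simps)
  with le[of c F] show ?thesis by simp
qed

text \<open>This is how local compactness of the group enters: \<open>G_space\<close> demands it of
  the space acted upon, and with it every fact of the locale also applies to left
  translation.\<close>

lemma translation_G_space:
  assumes "locally_compact_space (euclidean :: 'g::{topological_group_add,t2_space} topology)"
  shows "G_space ((+) :: 'g \<Rightarrow> 'g \<Rightarrow> 'g)"
proof
  show "continuous_on UNIV (\<lambda>(s, x). s + x :: 'g)"
    unfolding case_prod_unfold by (intro continuous_intros)
qed (use assms in \<open>simp_all add: add.assoc\<close>)

section \<open>Uniformly continuous functions, their functionals and orbit functions\<close>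

context G_space
begin

lemma translate_add: "translate act s (F + H) = translate act s F + translate act s H"
  and translate_cscale: "translate act s (cscale c F) = cscale c (translate act s F)"
  by (rule bcontfun_eqI; simp add: apply_translate apply_cscale)+

lemma LUC_add:
  assumes "F \<in> LUC act" "H \<in> LUC act"
  shows "F + H \<in> LUC act"
  using assms by (auto simp: LUC_def translate_add intro: continuous_intros)

lemma LUC_cscale:
  assumes "F \<in> LUC act"
  shows "cscale c F \<in> LUC act"
proof -
  have "((\<lambda>t. translate act t (cscale c F)) \<longlongrightarrow> translate act s (cscale c F)) (at s)" for s
  proof (rule LIM_zero_cancel, rule Lim_null_comparison)
    have "((\<lambda>t. translate act t F) \<longlongrightarrow> translate act s F) (at s)"
      using assms by (auto simp: LUC_def continuous_on_def)
    then show "((\<lambda>t. cmod c * norm (translate act t F - translate act s F)) \<longlongrightarrow> 0) (at s)"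
      by (intro tendsto_mult_right_zero tendsto_norm_zero) (simp add: LIM_zero)
    have "translate act t (cscale c F) - translate act s (cscale c F)
        = cscale c (translate act t F - translate act s F)" for t
      by (rule bcontfun_eqI) (simp add: translate_cscale apply_cscale algebra_simps)
    then show "\<forall>\<^sub>F t in at s. norm (translate act t (cscale c F) - translate act s (cscale c F))
        \<le> cmod c * norm (translate act t F - translate act s F)"
      by (simp add: norm_cscale)
  qed
  then show ?thesis by (auto simp: LUC_def continuous_on_def)
qed

lemma LUC_const: "const_bcontfun c \<in> LUC act"
proof -
  have "translate act s (const_bcontfun c) = const_bcontfun c" for s
    by (rule bcontfun_eqI) (simp add: apply_translate)
  then show ?thesis by (simp add: LUC_def)
qed

text \<open>Joint continuity and compactness of C make F(uy) uniformly close to F(y) for y in C and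
  u near the identity. Points that neither s nor s0 moves into C contribute nothing to the
  difference.\<close>

lemma compact_support_LUC:
  fixes F :: "'x \<Rightarrow>\<^sub>C complex"
  assumes C: "compact C" and F: "\<And>x. x \<notin> C \<Longrightarrow> F x = 0"
  shows "F \<in> LUC act"
proof -
  have joint: "continuous_on (UNIV \<times> C) (\<lambda>(u, y). F (act u y))"
  proof -
    have "continuous_on UNIV (apply_bcontfun F \<circ> (\<lambda>(u, y). act u y))"
      by (intro continuous_on_compose continuous_act continuous_on_apply_bcontfun)
    then show ?thesis
      by (auto simp: o_def split_beta intro: continuous_on_subset)
  qed
  have "((\<lambda>s. translate act s F) \<longlongrightarrow> translate act s0 F) (at s0)" for s0
  proof (rule tendstoI)
    fix e :: real assume e: "e > 0"
    obtain V where V: "0 \<in> V" "open V"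
      "\<forall>u\<in>V \<inter> UNIV. \<forall>y\<in>C. dist (case (u, y) of (u, y) \<Rightarrow> F (act u y)) (case (0, y) of (u, y) \<Rightarrow> F (act u y)) \<le> e / 2"
      using continuous_on_prod_compactE[OF joint C UNIV_I half_gt_zero[OF e]] by blast
    then have close: "dist (F (act u y)) (F y) \<le> e / 2" if "u \<in> V" "y \<in> C" for u y
      using that by (simp add: act_zero)
    \<comment> \<open>Two conditions, since either of the points s0 x and s x may be the one in C:
      the other is then reached from it by s - s0 or by s0 - s.\<close>
    define N where "N = (\<lambda>s. s + - s0) -` V \<inter> (\<lambda>s. s0 + - s) -` V"
    have "open N"
      unfolding N_def by (intro open_Int open_vimage V continuous_intros)
    moreover have "s0 \<in> N"
      using V(1) by (simp add: N_def)
    moreover have "dist (translate act s F) (translate act s0 F) < e" if s: "s \<in> N" for s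
    proof -
      have "dist (translate act s F x) (translate act s0 F x) \<le> e / 2" for x
      proof -
        have shift: "act (s + - s0) (act s0 x) = act s x" "act (s0 + - s) (act s x) = act s0 x"
          by (simp_all add: act_add[symmetric] add.assoc)
        consider "act s0 x \<in> C" | "act s x \<in> C" | "act s0 x \<notin> C" "act s x \<notin> C" by blast
        then show ?thesis
        proof cases
          case 1
          then show ?thesis
            using close[of "s + - s0" "act s0 x"] s shift(1)
            by (simp add: N_def apply_translate)
        next
          case 2
          then show ?thesis
            using close[of "s0 + - s" "act s x"] s shift(2)
            by (simp add: N_def apply_translate dist_commute)
        qed (use F e in \<open>simp add: apply_translate\<close>)
      qed
      then have "dist (translate act s F) (translate act s0 F) \<le> e / 2"
        by (rule dist_bound)
      with e show ?thesis by simp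
    qed
    ultimately show "\<forall>\<^sub>F s in at s0. dist (translate act s F) (translate act s0 F) < e"
      unfolding eventually_at_topological by blast
  qed
  then show ?thesis by (auto simp: LUC_def continuous_on_def)
qed

lemma LUC_dualD:
  assumes "M \<in> LUC_dual act"
  shows "F \<in> LUC act \<Longrightarrow> H \<in> LUC act \<Longrightarrow> M (F + H) = M F + M H"
    and "F \<in> LUC act \<Longrightarrow> M (cscale c F) = c * M F"
    and "F \<notin> LUC act \<Longrightarrow> M F = 0"
  using assms by (auto simp: LUC_dual_def)

lemma LUC_dual_bound:
  assumes "M \<in> LUC_dual act"
  obtains K where "0 \<le> K" "\<And>F. cmod (M F) \<le> K * norm F"
proof -
  obtain K where K: "\<And>F. F \<in> LUC act \<Longrightarrow> cmod (M F) \<le> K * norm F"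
    using assms unfolding LUC_dual_def by blast
  have "cmod (M F) \<le> max K 0 * norm F" for F
  proof (cases "F \<in> LUC act")
    case True
    then show ?thesis using K[of F] by (meson max.cobounded1 mult_right_mono norm_ge_zero order_trans)
  next
    case False
    then show ?thesis using LUC_dualD(3)[OF assms] by simp
  qed
  then show ?thesis by (intro that[of "max K 0"]) auto
qed

lemma LUC_dualI:
  assumes "\<And>F H. F \<in> LUC act \<Longrightarrow> H \<in> LUC act \<Longrightarrow> M (F + H) = M F + M H"
    and "\<And>c F. F \<in> LUC act \<Longrightarrow> M (cscale c F) = c * M F"
    and "\<And>F. F \<in> LUC act \<Longrightarrow> cmod (M F) \<le> K * norm F"
    and "\<And>F. F \<notin> LUC act \<Longrightarrow> M F = 0"
  shows "M \<in> LUC_dual act"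
  using assms unfolding LUC_dual_def by blast

lemma evaluation_LUC_dual: "(\<lambda>F. if F \<in> LUC act then F x else 0) \<in> LUC_dual act"
  by (rule LUC_dualI[where K = 1]) (auto simp: LUC_add LUC_cscale apply_cscale norm_bounded)

lemma orbit_fun_add:
  assumes "M \<in> LUC_dual act" "F \<in> LUC act" "H \<in> LUC act"
  shows "orbit_fun act M (F + H) = orbit_fun act M F + orbit_fun act M H"
  using assms by (intro bcontfun_eqI)
    (simp add: apply_orbit_fun LUC_add translate_add translate_LUC LUC_dualD(1))

lemma orbit_fun_cscale:
  assumes "M \<in> LUC_dual act" "F \<in> LUC act"
  shows "orbit_fun act M (cscale c F) = cscale c (orbit_fun act M F)"
  using assms by (intro bcontfun_eqI)
    (simp add: apply_orbit_fun LUC_cscale translate_cscale translate_LUC apply_cscale LUC_dualD(2))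

lemma norm_orbit_fun_le:
  assumes "M \<in> LUC_dual act" "F \<in> LUC act" "0 \<le> K" "\<And>F. cmod (M F) \<le> K * norm F"
  shows "norm (orbit_fun act M F) \<le> K * norm F"
  using assms by (intro norm_bound)
    (auto simp: apply_orbit_fun intro: order_trans[OF assms(4)] mult_left_mono norm_translate_le)

text \<open>Translation passes through M: the translate of MF by s is M applied to
  \<open>translate act s F\<close>. Continuity of translation on F therefore carries over, with the
  bound of M as Lipschitz constant.\<close>

lemma orbit_fun_LUC:
  assumes lc: "locally_compact_space (euclidean :: 'g topology)"
    and M: "M \<in> LUC_dual act" and F: "F \<in> LUC act"
  shows "orbit_fun act M F \<in> LUC (+)"
proof -
  interpret G: G_space "(+) :: 'g \<Rightarrow> 'g \<Rightarrow> 'g" using lc by (rule translation_G_space)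
  obtain K where K: "0 \<le> K" "\<And>F. cmod (M F) \<le> K * norm F" using LUC_dual_bound[OF M] by blast
  have shift: "translate (+) s (orbit_fun act M F) = orbit_fun act M (translate act s F)" for s
    using M F by (intro bcontfun_eqI)
      (simp add: G.apply_translate apply_orbit_fun translate_LUC translate_translate)
  have "((\<lambda>t. translate (+) t (orbit_fun act M F)) \<longlongrightarrow> translate (+) s (orbit_fun act M F)) (at s)" for s
  proof (rule LIM_zero_cancel, rule Lim_null_comparison)
    have "((\<lambda>t. translate act t F) \<longlongrightarrow> translate act s F) (at s)"
      using F by (auto simp: LUC_def continuous_on_def)
    then show "((\<lambda>t. K * norm (translate act t F - translate act s F)) \<longlongrightarrow> 0) (at s)"
      by (intro tendsto_mult_right_zero tendsto_norm_zero) (simp add: LIM_zero)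
    have "orbit_fun act M (translate act t F) - orbit_fun act M (translate act s F)
        = orbit_fun act M (translate act t F - translate act s F)" for t
    proof -
      have "orbit_fun act M ((translate act t F - translate act s F) + translate act s F)
          = orbit_fun act M (translate act t F - translate act s F) + orbit_fun act M (translate act s F)"
        by (intro orbit_fun_add M LUC_diff translate_LUC F)
      then show ?thesis by simp
    qed
    then show "\<forall>\<^sub>F t in at s. norm (translate (+) t (orbit_fun act M F) - translate (+) s (orbit_fun act M F))
        \<le> K * norm (translate act t F - translate act s F)"
      unfolding shift using M F K by (intro always_eventually allI) (simp add: norm_orbit_fun_le LUC_diff translate_LUC)
  qed
  then show ?thesis by (auto simp: LUC_def continuous_on_def)
qed

lemma module_act_LUC_dual:
  assumes lc: "locally_compact_space (euclidean :: 'g topology)"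
    and m: "m \<in> LUC_dual (+)" and M: "M \<in> LUC_dual act"
  shows "module_act act m M \<in> LUC_dual act"
proof -
  interpret G: G_space "(+) :: 'g \<Rightarrow> 'g \<Rightarrow> 'g" using lc by (rule translation_G_space)
  obtain K where K: "0 \<le> K" "\<And>F. cmod (M F) \<le> K * norm F" using LUC_dual_bound[OF M] by blast
  obtain L where L: "0 \<le> L" "\<And>f. cmod (m f) \<le> L * norm f" using G.LUC_dual_bound[OF m] by blast
  note orbit = orbit_fun_LUC[OF lc M]
  show ?thesis
  proof (rule LUC_dualI[where K = "L * K"])
    fix F assume F: "F \<in> LUC act"
    have "cmod (m (orbit_fun act M F)) \<le> L * norm (orbit_fun act M F)" by (rule L(2))
    also have "\<dots> \<le> L * (K * norm F)" using M F K L(1) by (intro mult_left_mono norm_orbit_fun_le)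
    finally show "cmod (module_act act m M F) \<le> L * K * norm F"
      using F by (simp add: module_act_def mult.assoc)
  qed (auto simp: module_act_def LUC_add LUC_cscale orbit_fun_add orbit_fun_cscale M orbit
      G.LUC_dualD(1)[OF m] G.LUC_dualD(2)[OF m])
qed

text \<open>
  The real functional \<open>\<phi>\<close> separating \<open>f\<close> from \<open>S\<close> is the real part of
  \<open>F \<mapsto> \<phi> F - \<i> \<phi> (\<i> F)\<close>.
\<close>

lemma LUC_dual_separation:
  assumes S: "bcontfun_complex.subspace S" and f: "f \<in> LUC act" "f \<notin> closure S"
  obtains m where "m \<in> LUC_dual act" "\<And>F. F \<in> S \<Longrightarrow> m F = 0" "m f \<noteq> 0"
proof -
  have scaleR: "r *\<^sub>R F = cscale (of_real r) F" for r and F :: "'x \<Rightarrow>\<^sub>C complex"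
    by (rule bcontfun_eqI) (simp add: apply_cscale scaleR_conv_of_real)
  have S_cscale: "cscale c F \<in> S" if "F \<in> S" for c F
    using S that by (rule bcontfun_complex.subspace_scale)
  have "subspace S"
    using S S_cscale by (auto simp: subspace_def scaleR bcontfun_complex.subspace_0 bcontfun_complex.subspace_add)
  then obtain \<phi> where \<phi>: "linear \<phi>" "\<And>F. \<bar>\<phi> F\<bar> \<le> norm F" "\<And>F. F \<in> S \<Longrightarrow> \<phi> F = 0" "\<phi> f > 0"
    using Hahn_Banach_separation[OF _ f(2)] by blast
  define \<psi> where "\<psi> = (\<lambda>F. Complex (\<phi> F) (- \<phi> (cscale \<i> F)))"
  have cscale_split: "cscale c F = Re c *\<^sub>R F + Im c *\<^sub>R cscale \<i> F" for c and F :: "'x \<Rightarrow>\<^sub>C complex"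
    by (rule bcontfun_eqI) (simp add: apply_cscale complex_eq_iff)
  have \<phi>_cscale: "\<phi> (cscale c F) = Re c * \<phi> F + Im c * \<phi> (cscale \<i> F)" for c F
    by (subst cscale_split) (simp add: linear_add[OF \<phi>(1)] linear_scale[OF \<phi>(1)])
  have \<psi>_cscale: "\<psi> (cscale c F) = c * \<psi> F" for c F
    unfolding \<psi>_def bcontfun_complex.scale_scale
    by (simp add: \<phi>_cscale[of c] \<phi>_cscale[of "\<i> * c"] complex_eq_iff)
  have \<psi>_add: "\<psi> (F + H) = \<psi> F + \<psi> H" for F H
    by (simp add: \<psi>_def bcontfun_complex.scale_right_distrib linear_add[OF \<phi>(1)] complex_eq_iff)
  have \<psi>_bound: "cmod (\<psi> F) \<le> 2 * norm F" for F
    using cmod_le[of "\<psi> F"] \<phi>(2)[of F] \<phi>(2)[of "cscale \<i> F"] by (simp add: \<psi>_def norm_cscale)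
  show ?thesis
  proof (rule that[of "\<lambda>F. if F \<in> LUC act then \<psi> F else 0"])
    show "(\<lambda>F. if F \<in> LUC act then \<psi> F else 0) \<in> LUC_dual act"
      by (rule LUC_dualI[where K = 2]) (simp_all add: LUC_add LUC_cscale \<psi>_cscale \<psi>_add \<psi>_bound)
    show "(if F \<in> LUC act then \<psi> F else 0) = 0" if "F \<in> S" for F
      using that \<phi>(3)[OF S_cscale] \<phi>(3)[of F] by (simp add: \<psi>_def complex_eq_iff)
    show "(if f \<in> LUC act then \<psi> f else 0) \<noteq> 0"
      using f(1) \<phi>(4) by (simp add: \<psi>_def complex_eq_iff)
  qed
qed

section \<open>Faithfulness, density of the orbit functions, and effectiveness\<close>

theorem faithful_iff_CLS_eq_LUC:
  assumes lc: "locally_compact_space (euclidean :: 'g topology)"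
  shows "faithful_module_act act \<longleftrightarrow> CLS act = LUC ((+) :: 'g \<Rightarrow> 'g \<Rightarrow> 'g)"
proof
  interpret G: G_space "(+) :: 'g \<Rightarrow> 'g \<Rightarrow> 'g" using lc by (rule translation_G_space)
  define T where "T = {orbit_fun act M F | M F. M \<in> LUC_dual act \<and> F \<in> LUC act}"
  define S where "S = bcontfun_complex.span T"
  have CLS: "CLS act = LUC (+) \<inter> closure S" by (simp add: CLS_def S_def T_def)
  have kills: "(\<forall>M\<in>LUC_dual act. module_act act m M = (\<lambda>_. 0)) \<longleftrightarrow> (\<forall>h\<in>T. m h = 0)" for m
    by (auto simp: module_act_def T_def fun_eq_iff)
  show "CLS act = LUC (+)" if faithful: "faithful_module_act act"
  proof (rule ccontr)
    assume "CLS act \<noteq> LUC (+)"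
    then obtain f where f: "f \<in> LUC (+)" "f \<notin> closure S" by (auto simp: CLS)
    obtain m where m: "m \<in> LUC_dual (+)" "\<And>F. F \<in> S \<Longrightarrow> m F = 0" "m f \<noteq> 0"
      using G.LUC_dual_separation[OF _ f] by (auto simp: S_def)
    then have "\<forall>h\<in>T. m h = 0"
      by (auto simp: S_def intro: bcontfun_complex.span_base)
    then have "m = (\<lambda>_. 0)"
      using faithful m(1) kills unfolding faithful_module_act_def by blast
    with m(3) show False by simp
  qed
  show "faithful_module_act act" if eq: "CLS act = LUC (+)"
    unfolding faithful_module_act_def kills
  proof (intro ballI impI ext)
    fix m :: "('g \<Rightarrow>\<^sub>C complex) \<Rightarrow> complex" and f
    assume m: "m \<in> LUC_dual (+)" and T: "\<forall>h\<in>T. m h = 0"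
    \<comment> \<open>Membership is carried along in the induction because m is known to be linear
      only on \<open>LUC (+)\<close>.\<close>
    have S: "h \<in> LUC (+) \<and> m h = 0" if "h \<in> S" for h
      using that unfolding S_def
    proof (induction rule: bcontfun_complex.span_induct_alt)
      case base
      show ?case
        using G.LUC_const[of 0] G.LUC_dualD(2)[OF m G.LUC_const[of 0], of 0] by simp
    next
      case (step c x y)
      then have "x \<in> LUC (+)" "m x = 0"
        using T orbit_fun_LUC[OF lc] by (auto simp: T_def)
      with step show ?case
        by (simp add: G.LUC_add G.LUC_cscale G.LUC_dualD(1,2)[OF m])
    qed
    show "m f = 0"
    proof (cases "f \<in> LUC (+)")
      case True
      then have "f \<in> closure S" using eq CLS by blast
      obtain K where K: "0 \<le> K" "\<And>f. cmod (m f) \<le> K * norm f" using G.LUC_dual_bound[OF m] by blast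
      have "cmod (m f) \<le> 0 + e" if e: "e > 0" for e
      proof -
        \<comment> \<open>The denominator K + 1 covers the case K = 0.\<close>
        obtain h where h: "h \<in> S" "dist h f < e / (K + 1)"
          using \<open>f \<in> closure S\<close> e K(1) unfolding closure_approachable by (metis add_nonneg_pos divide_pos_pos zero_less_one)
        have "m f = m (f - h)"
          using LUC_dual_diff[OF m True] S[OF h(1)] G.LUC_diff[OF True] by simp
        then have "cmod (m f) \<le> K * norm (f - h)" using K(2) by simp
        also have "\<dots> \<le> K * (e / (K + 1))"
          using h(2) K(1) by (intro mult_left_mono) (auto simp: dist_norm norm_minus_commute)
        also have "\<dots> \<le> e" using K(1) e by (simp add: field_simps)
        finally show ?thesis by simp
      qed
      then have "cmod (m f) \<le> 0" by (rule field_le_epsilon)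
      then show ?thesis by simp
    qed (simp add: G.LUC_dualD(3)[OF m])
  qed
qed

theorem faithful_imp_effective:
  assumes lc: "locally_compact_space (euclidean :: 'g topology)" and faithful: "faithful_module_act act"
  shows "effective_action act"
proof (rule ccontr)
  interpret G: G_space "(+) :: 'g \<Rightarrow> 'g \<Rightarrow> 'g" using lc by (rule translation_G_space)
  assume "\<not> effective_action act"
  then obtain s where s: "s \<noteq> 0" "\<And>x. act s x = x"
    using act_zero by (auto simp: effective_action_def action_kernel_def)
  define m where "m = (\<lambda>f :: 'g \<Rightarrow>\<^sub>C complex. if f \<in> LUC (+) then f s - f 0 else 0)"
  have m: "m \<in> LUC_dual (+)"
  proof (rule G.LUC_dualI[where K = 2])
    show "cmod (m f) \<le> 2 * norm f" for f
      using norm_triangle_ineq4[of "f s" "f 0"] norm_bounded[of f s] norm_bounded[of f 0]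
      by (simp add: m_def)
  qed (simp_all add: m_def G.LUC_add G.LUC_cscale apply_cscale algebra_simps)
  have "module_act act m M F = 0" if M: "M \<in> LUC_dual act" for M F
  proof (cases "F \<in> LUC act")
    case True
    \<comment> \<open>Hence MF takes the same value at s and at 0 for every M.\<close>
    have "translate act s F = translate act 0 F"
      by (rule bcontfun_eqI) (simp add: apply_translate s(2) act_zero)
    then show ?thesis
      using True M by (simp add: module_act_def m_def apply_orbit_fun)
  qed (simp add: module_act_def)
  then have "m = (\<lambda>_. 0)"
    using faithful m unfolding faithful_module_act_def by blast
  then have m0: "m f = 0" for f by simp
  have sep: "compact {s}" "open (- {0 :: 'g})" "{s} \<subseteq> - {0}"
    using s(1) by auto
  show False
  proof (rule Urysohn_compact_support[OF lc sep])
    fix f :: "'g \<Rightarrow>\<^sub>C complex" and C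
    assume f: "compact C" "\<And>t. t \<notin> C \<Longrightarrow> f t = 0" "\<And>t. t \<notin> - {0} \<Longrightarrow> f t = 0" "\<And>t. t \<in> {s} \<Longrightarrow> f t = 1"
    have "f s - f 0 = 0"
      using G.compact_support_LUC[OF f(1,2)] m0[of f] by (simp add: m_def)
    with f(3)[of 0] f(4)[of s] show False by simp
  qed
qed

end

section \<open>Measures as a submodule\<close>

lemma norm_integral_le:
  fixes F :: "'x::t2_space \<Rightarrow>\<^sub>C complex"
  assumes \<mu>: "finite_radon_measure \<mu>"
  shows "cmod (LINT x|\<mu>. F x) \<le> measure \<mu> UNIV * norm F"
proof -
  interpret finite_measure \<mu> using \<mu> by (rule finite_radon_measureD)
  have int: "integrable \<mu> (apply_bcontfun F)"
    using finite_radon_measureD[OF \<mu>] by (intro integrable_bcontfun apply_bcontfun)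
  have "cmod (LINT x|\<mu>. F x) \<le> (LINT x|\<mu>. cmod (F x))"
    by (rule integral_norm_bound)
  also have "\<dots> \<le> (LINT x|\<mu>. norm F)"
    using int by (intro integral_mono) (auto simp: norm_bounded)
  finally show ?thesis
    using finite_radon_measureD(3)[OF \<mu>] by simp
qed

lemma norm_integral_le_measure_Compl:
  fixes F :: "'x::t2_space \<Rightarrow>\<^sub>C complex"
  assumes \<mu>: "finite_radon_measure \<mu>" and K: "compact K"
    and F: "\<And>x. x \<in> K \<Longrightarrow> F x = 0" "\<And>x. cmod (F x) \<le> 1"
  shows "cmod (LINT x|\<mu>. F x) \<le> measure \<mu> (UNIV - K)"
proof -
  interpret finite_measure \<mu> using \<mu> by (rule finite_radon_measureD)
  have sets: "UNIV - K \<in> sets \<mu>"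
    using K finite_radon_measureD(2)[OF \<mu>] by (auto simp: compact_imp_closed)
  have int: "integrable \<mu> (apply_bcontfun F)"
    using finite_radon_measureD[OF \<mu>] by (intro integrable_bcontfun apply_bcontfun)
  have "cmod (LINT x|\<mu>. F x) \<le> (LINT x|\<mu>. cmod (F x))"
    by (rule integral_norm_bound)
  also have "\<dots> \<le> (LINT x|\<mu>. indicator (UNIV - K) x)"
  proof (rule integral_mono)
    show "integrable \<mu> (indicator (UNIV - K) :: 'x \<Rightarrow> real)"
      using sets by (intro integrable_const_bound[where B = 1] borel_measurable_indicator) auto
    show "cmod (F x) \<le> indicator (UNIV - K) x" for x
      using F by (simp add: indicator_def)
  qed (use int in simp)
  also have "\<dots> = measure \<mu> (UNIV - K)"
    using sets finite_radon_measureD(3)[OF \<mu>] by simp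
  finally show ?thesis .
qed

lemma integral_bcontfun_add:
  fixes F H :: "'x::t2_space \<Rightarrow>\<^sub>C complex"
  assumes "finite_radon_measure \<mu>"
  shows "(LINT x|\<mu>. (F + H) x) = (LINT x|\<mu>. F x) + (LINT x|\<mu>. H x)"
proof -
  have "integrable \<mu> (apply_bcontfun F)" for F :: "'x \<Rightarrow>\<^sub>C complex"
    by (rule integrable_bcontfun[OF finite_radon_measureD(1,2)[OF assms] apply_bcontfun])
  then show ?thesis by simp
qed

lemma integral_cscale: "(LINT x|\<mu>. cscale c F x) = c * (LINT x|\<mu>. F x)"
  by (simp add: apply_cscale)

context
  fixes \<sigma> :: "'x::t2_space set \<Rightarrow> complex"
  assumes \<sigma>: "complex_radon_measure \<sigma>"
begin

lemma complex_integral_add: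
  "complex_integral \<sigma> (F + H) = complex_integral \<sigma> F + complex_integral \<sigma> H" for F H :: "'x \<Rightarrow>\<^sub>C complex"
  using \<sigma> unfolding complex_integral_def signed_integral_def complex_radon_measure_def
  by (simp only: integral_bcontfun_add) (simp add: algebra_simps)

lemma complex_integral_cscale:
  "complex_integral \<sigma> (cscale c F) = c * complex_integral \<sigma> F" for F :: "'x \<Rightarrow>\<^sub>C complex"
  unfolding complex_integral_def signed_integral_def integral_cscale by (simp add: algebra_simps)

text \<open>The bound c depends on the measure so that one lemma serves both the norm bound, with c
  the total mass times the norm of F, and the tail bound, with c constant.\<close>

lemma norm_complex_integral_le:
  fixes F :: "'x \<Rightarrow> complex"
  assumes "\<And>\<mu>. \<mu> \<in> {pos_variation (\<lambda>E. Re (\<sigma> E)), neg_variation (\<lambda>E. Re (\<sigma> E)),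
      pos_variation (\<lambda>E. Im (\<sigma> E)), neg_variation (\<lambda>E. Im (\<sigma> E))} \<Longrightarrow> cmod (LINT x|\<mu>. F x) \<le> c \<mu>"
  shows "cmod (complex_integral \<sigma> F) \<le> c (pos_variation (\<lambda>E. Re (\<sigma> E))) + c (neg_variation (\<lambda>E. Re (\<sigma> E)))
    + c (pos_variation (\<lambda>E. Im (\<sigma> E))) + c (neg_variation (\<lambda>E. Im (\<sigma> E)))"
proof -
  have triangle: "cmod (a - b + \<i> * (d - e)) \<le> cmod a + cmod b + cmod d + cmod e" for a b d e
  proof -
    have "cmod (a - b + \<i> * (d - e)) \<le> cmod (a - b) + cmod (\<i> * (d - e))" by (rule norm_triangle_ineq)
    also have "\<dots> = cmod (a - b) + cmod (d - e)" by (simp add: norm_mult)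
    finally show ?thesis
      using norm_triangle_ineq4[of a b] norm_triangle_ineq4[of d e] by linarith
  qed
  show ?thesis
    unfolding complex_integral_def signed_integral_def
    by (rule order_trans[OF triangle], intro add_mono assms) auto
qed

lemma measure_functional_LUC_dual:
  fixes act :: "'g::{topological_group_add,t2_space} \<Rightarrow> 'x \<Rightarrow> 'x"
  assumes "G_space act"
  shows "measure_functional act \<sigma> \<in> LUC_dual act"
proof -
  interpret G_space act by fact
  note bound = norm_complex_integral_le[OF norm_integral_le]
  show ?thesis
  proof (rule LUC_dualI)
    fix F :: "'x \<Rightarrow>\<^sub>C complex" assume "F \<in> LUC act"
    then show "cmod (measure_functional act \<sigma> F) \<le>
        (measure (pos_variation (\<lambda>E. Re (\<sigma> E))) UNIV + measure (neg_variation (\<lambda>E. Re (\<sigma> E))) UNIV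
        + measure (pos_variation (\<lambda>E. Im (\<sigma> E))) UNIV + measure (neg_variation (\<lambda>E. Im (\<sigma> E))) UNIV) * norm F"
      using bound[of F] \<sigma> by (auto simp: measure_functional_def complex_radon_measure_def distrib_right)
  qed (simp_all add: measure_functional_def LUC_add LUC_cscale complex_integral_add complex_integral_cscale
      del: plus_bcontfun.rep_eq)
qed

text \<open>Tightness: each of the four variations has mass below e/4 off some compact set, and K is
  the union of these sets.\<close>

lemma complex_integral_small_off_compact:
  assumes e: "e > 0"
  obtains K where "compact K"
    "\<And>F :: 'x \<Rightarrow>\<^sub>C complex. (\<And>x. x \<in> K \<Longrightarrow> F x = 0) \<Longrightarrow> (\<And>x. cmod (F x) \<le> 1) \<Longrightarrow> cmod (complex_integral \<sigma> F) \<le> e"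
proof -
  let ?V = "{pos_variation (\<lambda>E. Re (\<sigma> E)), neg_variation (\<lambda>E. Re (\<sigma> E)),
      pos_variation (\<lambda>E. Im (\<sigma> E)), neg_variation (\<lambda>E. Im (\<sigma> E))}"
  have radon: "finite_radon_measure \<mu>" if "\<mu> \<in> ?V" for \<mu>
    using that \<sigma> by (auto simp: complex_radon_measure_def)
  have "\<exists>K. compact K \<and> measure \<mu> (UNIV - K) < e / 4" if "\<mu> \<in> ?V" for \<mu>
    using finite_radon_measure_approx[OF radon[OF that], of UNIV "e / 4"] e by auto
  then obtain K where K: "\<And>\<mu>. \<mu> \<in> ?V \<Longrightarrow> compact (K \<mu>)" "\<And>\<mu>. \<mu> \<in> ?V \<Longrightarrow> measure \<mu> (UNIV - K \<mu>) < e / 4"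
    by metis
  show ?thesis
  proof (rule that[of "\<Union> (K ` ?V)"])
    show "compact (\<Union> (K ` ?V))"
      by (rule compact_UN) (use K(1) in simp_all)
    fix F :: "'x \<Rightarrow>\<^sub>C complex"
    assume F: "\<And>x. x \<in> \<Union> (K ` ?V) \<Longrightarrow> F x = 0" "\<And>x. cmod (F x) \<le> 1"
    have "cmod (LINT x|\<mu>. F x) \<le> e / 4" if "\<mu> \<in> ?V" for \<mu>
      using norm_integral_le_measure_Compl[OF radon[OF that] K(1)[OF that] _ F(2)] F(1) K(2)[OF that] that
      by (meson UN_I less_imp_le order_trans)
    from norm_complex_integral_le[OF this] show "cmod (complex_integral \<sigma> F) \<le> e" by simp
  qed
qed

end

lemma measure_functionalsI:
  assumes "complex_radon_measure \<sigma>" "\<And>F. F \<in> LUC act \<Longrightarrow> M F = complex_integral \<sigma> F"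
    "\<And>F. F \<notin> LUC act \<Longrightarrow> M F = 0"
  shows "M \<in> measure_functionals act"
proof -
  have "M = measure_functional act \<sigma>" using assms by (auto simp: measure_functional_def)
  with assms(1) show ?thesis by (simp add: measure_functionals_def)
qed

section \<open>Functionals on a compact space are measures\<close>

definition complex_bcontfun :: "('x::topological_space \<Rightarrow> real) \<Rightarrow> 'x \<Rightarrow>\<^sub>C complex" where
  "complex_bcontfun f = Bcontfun (\<lambda>x. of_real (f x))"

lemma apply_complex_bcontfun:
  assumes "f \<in> bcontfun"
  shows "complex_bcontfun f x = of_real (f x)"
proof -
  obtain b where "\<And>x. \<bar>f x\<bar> \<le> b" using bcontfun_bound[OF assms] by blast
  then have "(\<lambda>x. complex_of_real (f x)) \<in> bcontfun"
    using assms by (intro bcontfun_normI[of _ b]) (auto simp: bcontfun_def intro!: continuous_intros)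
  then show ?thesis by (simp add: complex_bcontfun_def Bcontfun_inverse)
qed

text \<open>Every F belongs to \<open>LUC act\<close>, as its support lies in the compact space
  itself. The real and imaginary parts of M on real functions are bounded real functionals; each
  yields two measures, and complex linearity recovers M from them.\<close>

theorem (in G_space) Riesz_representation_LUC_dual:
  assumes compact: "compact (UNIV :: 'x set)" and M: "M \<in> LUC_dual act"
  shows "M \<in> measure_functionals act"
proof -
  have LUC: "F \<in> LUC act" for F :: "'x \<Rightarrow>\<^sub>C complex"
    using compact by (rule compact_support_LUC) simp
  obtain K where K: "0 \<le> K" "\<And>F. cmod (M F) \<le> K * norm F" using LUC_dual_bound[OF M] by blast
  let ?c = complex_bcontfun
  have c_add: "?c (\<lambda>x. f x + g x) = ?c f + ?c g" if "f \<in> bcontfun" "g \<in> bcontfun" for f g :: "'x \<Rightarrow> real"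
    using that by (intro bcontfun_eqI) (simp add: apply_complex_bcontfun plus_cont)
  have c_scale: "?c (\<lambda>x. r * f x) = cscale (of_real r) (?c f)" if "f \<in> bcontfun" for r and f :: "'x \<Rightarrow> real"
    using that by (intro bcontfun_eqI) (simp add: apply_complex_bcontfun mult_const_bcontfun apply_cscale)
  have c_norm: "cmod (M (?c f)) \<le> K * b" if "f \<in> bcontfun" "\<And>x. \<bar>f x\<bar> \<le> b" for b and f :: "'x \<Rightarrow> real"
  proof -
    have "norm (?c f) \<le> b" using that by (intro norm_bound) (simp add: apply_complex_bcontfun)
    then show ?thesis using K mult_left_mono order_trans by blast
  qed
  have "bounded_functional (\<lambda>f. Re (M (?c f))) K"
    using c_norm abs_Re_le_cmod order_trans
    by unfold_locales (auto simp: c_add c_scale LUC_dualD(1,2)[OF M] LUC, blast)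
  from Riesz_representation_signed[OF compact this] obtain \<mu>1 \<mu>2
    where \<mu>12: "finite_radon_measure \<mu>1" "finite_radon_measure \<mu>2"
      and Re: "\<And>f. f \<in> bcontfun \<Longrightarrow> Re (M (?c f)) = (LINT x|\<mu>1. f x) - (LINT x|\<mu>2. f x)"
    by blast
  have "bounded_functional (\<lambda>f. Im (M (?c f))) K"
    using c_norm abs_Im_le_cmod order_trans
    by unfold_locales (auto simp: c_add c_scale LUC_dualD(1,2)[OF M] LUC, blast)
  from Riesz_representation_signed[OF compact this] obtain \<mu>3 \<mu>4
    where \<mu>34: "finite_radon_measure \<mu>3" "finite_radon_measure \<mu>4"
      and Im: "\<And>f. f \<in> bcontfun \<Longrightarrow> Im (M (?c f)) = (LINT x|\<mu>3. f x) - (LINT x|\<mu>4. f x)"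
    by blast
  note \<sigma> = complex_radon_measure_four[OF \<mu>12 \<mu>34]
  show ?thesis
  proof (rule measure_functionalsI[OF \<sigma>(1)])
    fix F :: "'x \<Rightarrow>\<^sub>C complex"
    let ?r = "\<lambda>x. Re (F x)" and ?i = "\<lambda>x. Im (F x)"
    have r: "?r \<in> bcontfun" and i: "?i \<in> bcontfun"
      using Re_bcontfun Im_bcontfun apply_bcontfun by blast+
    have "F = ?c ?r + cscale \<i> (?c ?i)"
      using r i by (intro bcontfun_eqI) (simp add: apply_complex_bcontfun apply_cscale complex_eq_iff)
    then have "M F = M (?c ?r) + \<i> * M (?c ?i)"
      using LUC_dualD(1)[OF M LUC LUC] LUC_dualD(2)[OF M LUC] by metis
    moreover have "integrable \<mu> (apply_bcontfun F)" if "\<mu> \<in> {\<mu>1, \<mu>2, \<mu>3, \<mu>4}" for \<mu>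
      using that \<mu>12 \<mu>34 finite_radon_measureD by (intro integrable_bcontfun apply_bcontfun) auto
    ultimately show "M F = complex_integral (\<lambda>E. Complex (measure \<mu>1 E - measure \<mu>2 E) (measure \<mu>3 E - measure \<mu>4 E)) F"
      using Re[OF r] Im[OF r] Re[OF i] Im[OF i]
      by (simp add: \<sigma>(2) apply_bcontfun complex_eq_iff)
  qed (use LUC in simp)
qed

theorem (in G_space) measures_submodule_if_compact:
  assumes "locally_compact_space (euclidean :: 'g topology)" "compact (UNIV :: 'x set)"
  shows "measures_submodule act"
  unfolding measures_submodule_def
proof (intro ballI)
  fix m :: "('g \<Rightarrow>\<^sub>C complex) \<Rightarrow> complex" and M
  assume m: "m \<in> LUC_dual (+)" and "M \<in> measure_functionals act"
  then have "M \<in> LUC_dual act"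
    using measure_functional_LUC_dual[OF _ G_space_axioms] by (auto simp: measure_functionals_def)
  with m assms show "module_act act m M \<in> measure_functionals act"
    by (intro Riesz_representation_LUC_dual module_act_LUC_dual)
qed

section \<open>Point masses and the noncompact transitive case\<close>

definition point_mass :: "'x::topological_space \<Rightarrow> 'x measure" where
  "point_mass x = distr (count_space {x}) borel (\<lambda>y. y)"

lemma emeasure_point_mass: "B \<in> sets borel \<Longrightarrow> emeasure (point_mass x) B = indicator B x"
  unfolding point_mass_def by (subst emeasure_distr) (auto simp: indicator_def emeasure_count_space Int_insert_right)

lemma finite_radon_measure_point_mass: "finite_radon_measure (point_mass x)" for x :: "'x::t2_space"
  unfolding finite_radon_measure_def
proof (intro conjI ballI)
  show sets: "sets (point_mass x) = sets borel" by (simp add: point_mass_def)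
  show "finite_measure (point_mass x)"
    by (intro finite_measureI) (simp add: emeasure_point_mass sets_eq_imp_space_eq[OF sets])
  fix B :: "'x set" assume B: "B \<in> sets borel"
  show "emeasure (point_mass x) B = (SUP K\<in>{K. compact K \<and> K \<subseteq> B}. emeasure (point_mass x) K)" (is "_ = ?S")
  proof (rule antisym)
    \<comment> \<open>This compact subset of B carries all the mass that the point mass gives to
      B.\<close>
    have "compact (B \<inter> {x})" by (cases "x \<in> B") auto
    then have "emeasure (point_mass x) (B \<inter> {x}) \<le> ?S"
      by (intro SUP_upper) auto
    then show "emeasure (point_mass x) B \<le> ?S"
      using B by (simp add: emeasure_point_mass indicator_def)
    show "?S \<le> emeasure (point_mass x) B"
      using B by (intro SUP_least emeasure_mono) (auto simp: sets)
  qed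
qed

lemma integral_point_mass:
  fixes F :: "'x::topological_space \<Rightarrow> complex"
  assumes "F \<in> borel_measurable borel"
  shows "(LINT y|point_mass x. F y) = F x"
  unfolding point_mass_def using assms
  by (subst integral_distr) (auto simp: lebesgue_integral_count_space_finite)

lemma finite_radon_measure_null: "finite_radon_measure (null_measure borel :: 'x::t2_space measure)"
  unfolding finite_radon_measure_def by (auto intro!: finite_measureI antisym SUP_least)

text \<open>The point mass fills the positive real slot of
  \<open>complex_radon_measure_four\<close>; null measures fill the other three.\<close>

lemma (in G_space) evaluation_measure_functional:
  "(\<lambda>F. if F \<in> LUC act then F x else 0) \<in> measure_functionals act"
proof (rule measure_functionalsI[OF complex_radon_measure_four(1)[OF finite_radon_measure_point_mass[of x]
      finite_radon_measure_null finite_radon_measure_null finite_radon_measure_null]])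
  fix F assume "F \<in> LUC act"
  have "apply_bcontfun F \<in> borel_measurable borel"
    by (intro bcontfun_borel apply_bcontfun)
  then have "(LINT y|point_mass x. F y) = F x"
    by (rule integral_point_mass)
  then show "(if F \<in> LUC act then F x else 0) = complex_integral
      (\<lambda>E. Complex (measure (point_mass x) E - measure (null_measure borel) E)
        (measure (null_measure borel) E - measure (null_measure borel) E)) F"
    using \<open>F \<in> LUC act\<close> complex_radon_measure_four(2)[OF finite_radon_measure_point_mass[of x]
      finite_radon_measure_null finite_radon_measure_null finite_radon_measure_null apply_bcontfun[of F]]
    by simp
qed simp

text \<open>
  If \<open>X\<close> is not compact, then \<open>1\<close> has distance at least \<open>1\<close> from the functions
  \<open>s \<mapsto> F (s x)\<close> with \<open>F\<close> compactly supported, so some \<open>m\<close> kills them but not \<open>1\<close>.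
  Then \<open>m \<cdot> \<delta>\<^sub>x\<close> is a nonzero functional vanishing on all compactly supported functions.
\<close>

theorem (in G_space) compact_if_measures_submodule:
  assumes lc: "locally_compact_space (euclidean :: 'g topology)"
    and transitive: "transitive_action act" and submodule: "measures_submodule act"
  shows "compact (UNIV :: 'x set)"
proof (rule ccontr)
  assume noncompact: "\<not> compact (UNIV :: 'x set)"
  interpret G: G_space "(+) :: 'g \<Rightarrow> 'g \<Rightarrow> 'g" using lc by (rule translation_G_space)
  \<comment> \<open>An arbitrary base point; one exists because HOL types are nonempty.\<close>
  fix x :: 'x
  define M where "M = (\<lambda>F :: 'x \<Rightarrow>\<^sub>C complex. if F \<in> LUC act then F x else 0)"
  have M: "M \<in> LUC_dual act" unfolding M_def by (rule evaluation_LUC_dual)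
  have orbit: "orbit_fun act M F s = F (act s x)" if "F \<in> LUC act" for F s
    unfolding apply_orbit_fun[OF M that] by (simp add: translate_LUC that M_def apply_translate)
  define Cc where "Cc = {F :: 'x \<Rightarrow>\<^sub>C complex. \<exists>C. compact C \<and> (\<forall>y. y \<notin> C \<longrightarrow> F y = 0)}"
  have Cc_LUC: "F \<in> LUC act" if "F \<in> Cc" for F
    using that compact_support_LUC by (auto simp: Cc_def)
  define S where "S = orbit_fun act M ` Cc"
  have "bcontfun_complex.subspace S"
  proof (rule bcontfun_complex.subspaceI)
    have "0 \<in> Cc" by (auto simp: Cc_def intro!: exI[of _ "{}"])
    moreover have "orbit_fun act M 0 = 0"
      using Cc_LUC[OF \<open>0 \<in> Cc\<close>] by (intro bcontfun_eqI) (simp add: orbit)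
    ultimately show "0 \<in> S" unfolding S_def by force
  next
    fix f h assume "f \<in> S" "h \<in> S"
    then obtain F H where F: "F \<in> Cc" "f = orbit_fun act M F" and H: "H \<in> Cc" "h = orbit_fun act M H"
      by (auto simp: S_def)
    obtain C D where "compact C" "\<forall>y. y \<notin> C \<longrightarrow> F y = 0" "compact D" "\<forall>y. y \<notin> D \<longrightarrow> H y = 0"
      using F(1) H(1) by (auto simp: Cc_def)
    then have "F + H \<in> Cc"
      by (auto simp: Cc_def intro!: exI[of _ "C \<union> D"])
    moreover have "f + h = orbit_fun act M (F + H)"
      using F H by (simp add: orbit_fun_add[OF M] Cc_LUC)
    ultimately show "f + h \<in> S" by (simp add: S_def)
  next
    fix c f assume "f \<in> S"
    then obtain F where F: "F \<in> Cc" "f = orbit_fun act M F" by (auto simp: S_def)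
    then have "cscale c F \<in> Cc" by (auto simp: Cc_def apply_cscale)
    moreover have "cscale c f = orbit_fun act M (cscale c F)"
      using F by (simp add: orbit_fun_cscale[OF M] Cc_LUC)
    ultimately show "cscale c f \<in> S" by (simp add: S_def)
  qed
  moreover have "const_bcontfun 1 \<notin> closure S"
  proof
    assume "const_bcontfun 1 \<in> closure S"
    then obtain h where "h \<in> S" and h: "dist h (const_bcontfun 1) < 1"
      unfolding closure_approachable by (meson zero_less_one)
    then obtain F where F: "F \<in> Cc" "h = orbit_fun act M F" by (auto simp: S_def)
    then obtain C where C: "compact C" "\<forall>y. y \<notin> C \<longrightarrow> F y = 0" by (auto simp: Cc_def)
    then obtain y where "y \<notin> C" using noncompact by (metis UNIV_eq_I)
    \<comment> \<open>Transitivity carries x out of C, so h has a zero and cannot be closer than 1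
      to the constant 1.\<close>
    obtain s where "y = act s x" using transitive by (auto simp: transitive_action_def)
    then have "h s = 0" using F Cc_LUC C(2) \<open>y \<notin> C\<close> by (simp add: orbit)
    then show False using dist_bounded[of h s "const_bcontfun 1"] h by (simp add: dist_norm)
  qed
  ultimately obtain m where m: "m \<in> LUC_dual (+)" "\<And>h. h \<in> S \<Longrightarrow> m h = 0" "m (const_bcontfun 1) \<noteq> 0"
    using G.LUC_dual_separation[OF _ G.LUC_const] by blast
  have "module_act act m M \<in> measure_functionals act"
    using submodule m(1) evaluation_measure_functional[of x] by (simp add: measures_submodule_def M_def)
  then obtain \<sigma> where \<sigma>: "complex_radon_measure \<sigma>" "module_act act m M = measure_functional act \<sigma>"
    by (auto simp: measure_functionals_def)
  have m_\<sigma>: "m (orbit_fun act M F) = complex_integral \<sigma> F" if "F \<in> LUC act" for F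
    using that fun_cong[OF \<sigma>(2), of F] by (simp add: module_act_def measure_functional_def)
  have "orbit_fun act M (const_bcontfun 1) = const_bcontfun 1"
    by (rule bcontfun_eqI) (simp add: orbit LUC_const)
  then have one: "complex_integral \<sigma> (const_bcontfun 1 :: 'x \<Rightarrow>\<^sub>C complex) \<noteq> 0"
    using m_\<sigma>[OF LUC_const, of 1] m(3) by simp
  \<comment> \<open>The tolerance is half the modulus of the nonzero integral of 1. That integral
    equals the integral of 1 - F for a compactly supported F equal to 1 on K, so its modulus would
    be at most half of itself.\<close>
  then obtain K where K: "compact K" "\<And>F :: 'x \<Rightarrow>\<^sub>C complex. (\<And>y. y \<in> K \<Longrightarrow> F y = 0) \<Longrightarrow> (\<And>y. cmod (F y) \<le> 1) \<Longrightarrow>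
      cmod (complex_integral \<sigma> F) \<le> cmod (complex_integral \<sigma> (const_bcontfun 1 :: 'x \<Rightarrow>\<^sub>C complex)) / 2"
    using complex_integral_small_off_compact[OF \<sigma>(1), of "cmod (complex_integral \<sigma> (const_bcontfun 1 :: 'x \<Rightarrow>\<^sub>C complex)) / 2"]
    by auto
  show False
  proof (rule Urysohn_compact_support[OF locally_compact K(1) open_UNIV subset_UNIV])
    fix F :: "'x \<Rightarrow>\<^sub>C complex" and C
    assume F: "compact C" "\<And>y. y \<notin> C \<Longrightarrow> F y = 0" "\<And>y. y \<in> K \<Longrightarrow> F y = 1" "\<And>y. cmod (1 - F y) \<le> 1"
    have "F \<in> Cc" using F(1,2) by (auto simp: Cc_def)
    then have "complex_integral \<sigma> F = 0"
      using m_\<sigma>[OF Cc_LUC] m(2) by (simp add: S_def)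
    then have "complex_integral \<sigma> (const_bcontfun 1 :: 'x \<Rightarrow>\<^sub>C complex) = complex_integral \<sigma> (const_bcontfun 1 - F)"
      using complex_integral_add[OF \<sigma>(1), of "const_bcontfun 1 - F" F] by simp
    moreover have "cmod (complex_integral \<sigma> (const_bcontfun 1 - F))
        \<le> cmod (complex_integral \<sigma> (const_bcontfun 1 :: 'x \<Rightarrow>\<^sub>C complex)) / 2"
      using F(3,4) by (intro K(2)) auto
    ultimately show False using one by simp
  qed
qed

theorem proposition3p5:
  fixes act :: "'g::{topological_group_add,t2_space} \<Rightarrow> 'x::t2_space \<Rightarrow> 'x"
  assumes "locally_compact_space (euclidean :: 'g topology)"
    and "G_space act"
  shows "(faithful_module_act act \<longleftrightarrow> CLS act = LUC ((+) :: 'g \<Rightarrow> 'g \<Rightarrow> 'g)) \<and>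
    (faithful_module_act act \<longrightarrow> effective_action act) \<and>
    (compact (UNIV :: 'x set) \<longrightarrow> measures_submodule act) \<and>
    (transitive_action act \<longrightarrow> measures_submodule act \<longrightarrow> compact (UNIV :: 'x set))"
proof -
  interpret G_space act by fact
  show ?thesis
    using assms(1) faithful_iff_CLS_eq_LUC faithful_imp_effective measures_submodule_if_compact
      compact_if_measures_submodule by blast
qed

end
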